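(* Let $R=\mathbb Z[u_{s,i}^{\pm1},u_{t,j}^{\pm1},u_{u,l}^{\pm1}]_{1\le i,j\le 2,\,1\le l\le 3}$ and let $$H_{G_{15}}=\Big\langle s,t,u\ \Big|\ stu=tus,\ ustut=stutu,\ \prod_{i=1}^2(s-u_{s,i})=\prod_{j=1}^2(t-u_{t,j})=\prod_{l=1}^3(u-u_{u,l})=0\Big\rangle$$ be the generic Hecke algebra (an associative unital $R$-algebra) of $G_{15}$. Let $u_1,u_2,u_3$ be the $R$-subalgebras generated by $s$, $t$, $u$ respectively, let $z=stutu$, and let $U=\sum_{k=0}^{11}z^ku_3u_2u_1u_2u_1$. Then $H_{G_{15}}=U$.
   Context: For subsets $X,Y$ of an $R$-algebra, $XY$ denotes the $R$-submodule spanned by the products $xy$. *)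

theory Defs
  imports Complex_Main "HOL-Library.Poly_Mapping"
begin

section \<open>The ring of Laurent polynomials in the seven parameters\<close>

text \<open>\<open>Us1\<close> stands for the index of the parameter \<open>u\<^sub>s\<^sub>,\<^sub>1\<close>, and so on.\<close>

datatype param = Us1 | Us2 | Ut1 | Ut2 | Uu1 | Uu2 | Uu3

text \<open>
  Keys are finitely supported exponent vectors with entries in \<int>; as \<^typ>\<open>param\<close> is finite these
  are all of \<open>\<int>\<^sup>7\<close>, and the convolution product of \<^theory>\<open>HOL-Library.Poly_Mapping\<close> makes this
  the group ring of \<open>\<int>\<^sup>7\<close> over \<int>, i.e. the ring of integral Laurent polynomials.
\<close>

type_synonym laurent = "(param \<Rightarrow>\<^sub>0 int) \<Rightarrow>\<^sub>0 int"

definition par :: "param \<Rightarrow> laurent" where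
  "par p = Poly_Mapping.single (Poly_Mapping.single p 1) 1"

lemma par_invertible: "par p * Poly_Mapping.single (Poly_Mapping.single p (- 1)) 1 = 1"
  by (simp add: par_def mult_single flip: single_add)


section \<open>The free associative algebra on three letters\<close>

datatype letter = Ls | Lt | Lu

text \<open>
  The free monoid. It is written additively because \<^theory>\<open>HOL-Library.Poly_Mapping\<close> forms
  monoid algebras from additive (not necessarily commutative) monoids.
\<close>

datatype word = Word (letters: "letter list")

instantiation word :: monoid_add
begin

definition "0 = Word []"

definition "v + w = Word (letters v @ letters w)"

instance
  by standard (simp_all add: zero_word_def plus_word_def)

end

type_synonym free_alg = "word \<Rightarrow>\<^sub>0 laurent"

definition fconst :: "laurent \<Rightarrow> free_alg" where
  "fconst c = Poly_Mapping.single 0 c"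

definition fgen :: "letter \<Rightarrow> free_alg" where
  "fgen l = Poly_Mapping.single (Word [l]) 1"

lemma fconst_add: "fconst (a + b) = fconst a + fconst b"
  by (simp add: fconst_def single_add)

lemma fconst_mult: "fconst (a * b) = fconst a * fconst b"
  by (simp add: fconst_def mult_single)

lemma fconst_one: "fconst 1 = 1"
  by (simp add: fconst_def)

lemma sum_singles: "f = (\<Sum>w\<in>Poly_Mapping.keys f. Poly_Mapping.single w (Poly_Mapping.lookup f w))"
  by (rule poly_mapping_eqI)
    (auto simp: lookup_sum lookup_single when_def in_keys_iff sum.delta')

lemma fconst_central: "fconst c * x = x * fconst c"
proof -
  have "fconst c * (\<Sum>w\<in>K. Poly_Mapping.single w (g w)) = (\<Sum>w\<in>K. Poly_Mapping.single w (g w)) * fconst c"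
    for K :: "word set" and g
    by (simp add: sum_distrib_left sum_distrib_right fconst_def mult_single mult.commute)
  from this[where K = "Poly_Mapping.keys x" and g = "Poly_Mapping.lookup x"] show ?thesis
    by (simp only: sum_singles[symmetric])
qed


section \<open>Ideals generated by a set\<close>

definition two_sided_ideal :: "'a::ring_1 set \<Rightarrow> bool" where
  "two_sided_ideal I \<longleftrightarrow>
     0 \<in> I \<and> (\<forall>x\<in>I. \<forall>y\<in>I. x + y \<in> I) \<and> (\<forall>x\<in>I. \<forall>a b. a * x * b \<in> I)"

lemma two_sided_ideal_hull: "two_sided_ideal (two_sided_ideal hull S)"
  by (rule hull_in) (auto simp: two_sided_ideal_def)

context
  fixes I :: "'a::ring_1 set"
  assumes I: "two_sided_ideal I"
begin

lemma ideal_zero: "0 \<in> I"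
  and ideal_add: "x \<in> I \<Longrightarrow> y \<in> I \<Longrightarrow> x + y \<in> I"
  and ideal_mult: "x \<in> I \<Longrightarrow> a * x * b \<in> I"
  using I by (auto simp: two_sided_ideal_def)

lemma ideal_mult_left: "x \<in> I \<Longrightarrow> a * x \<in> I"
  using ideal_mult[of x a 1] by simp

lemma ideal_mult_right: "x \<in> I \<Longrightarrow> x * b \<in> I"
  using ideal_mult[of x 1 b] by simp

lemma ideal_uminus: "x \<in> I \<Longrightarrow> - x \<in> I"
  using ideal_mult_left[of x "- 1"] by simp

lemma ideal_equivp: "equivp (\<lambda>x y. x - y \<in> I)"
proof (rule equivpI)
  show "reflp (\<lambda>x y. x - y \<in> I)"
    by (auto intro!: reflpI ideal_zero)
  show "symp (\<lambda>x y. x - y \<in> I)"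
    using ideal_uminus by (fastforce intro!: sympI)
  show "transp (\<lambda>x y. x - y \<in> I)"
  proof (rule transpI)
    fix x y z
    assume "x - y \<in> I" "y - z \<in> I"
    from ideal_add[OF this] show "x - z \<in> I"
      by simp
  qed
qed

lemma ideal_cong_add: "x - x' \<in> I \<Longrightarrow> y - y' \<in> I \<Longrightarrow> (x + y) - (x' + y') \<in> I"
  using ideal_add[of "x - x'" "y - y'"] by (simp add: algebra_simps)

lemma ideal_cong_uminus: "x - x' \<in> I \<Longrightarrow> - x - (- x') \<in> I"
  using ideal_uminus[of "x - x'"] by simp

lemma ideal_cong_diff: "x - x' \<in> I \<Longrightarrow> y - y' \<in> I \<Longrightarrow> (x - y) - (x' - y') \<in> I"
  using ideal_add[of "x - x'" "- (y - y')"] ideal_uminus[of "y - y'"]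
  by (simp add: algebra_simps)

lemma ideal_cong_mult: "x - x' \<in> I \<Longrightarrow> y - y' \<in> I \<Longrightarrow> x * y - x' * y' \<in> I"
  using ideal_add[OF ideal_mult_right[of "x - x'" y] ideal_mult_left[of "y - y'" x']]
  by (simp add: algebra_simps)

end


section \<open>The generic Hecke algebra of \<open>G\<^sub>1\<^sub>5\<close>\<close>

definition hecke_relators :: "free_alg set" where
  "hecke_relators =
    (let s = fgen Ls; t = fgen Lt; u = fgen Lu in
      {s * t * u - t * u * s,
       u * s * t * u * t - s * t * u * t * u,
       (s - fconst (par Us1)) * (s - fconst (par Us2)),
       (t - fconst (par Ut1)) * (t - fconst (par Ut2)),
       (u - fconst (par Uu1)) * (u - fconst (par Uu2)) * (u - fconst (par Uu3))})"

definition hecke_ideal :: "free_alg set" where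
  "hecke_ideal = two_sided_ideal hull hecke_relators"

lemma two_sided_ideal_hecke_ideal: "two_sided_ideal hecke_ideal"
  by (simp add: hecke_ideal_def two_sided_ideal_hull)

subsection \<open>The ideal is proper\<close>

text \<open>
  The type class \<^class>\<open>ring_1\<close> demands \<open>0 \<noteq> 1\<close>. This is witnessed by the linear character
  with \<open>s \<mapsto> u\<^sub>s\<^sub>,\<^sub>1\<close>, \<open>t \<mapsto> u\<^sub>t\<^sub>,\<^sub>1\<close>, \<open>u \<mapsto> u\<^sub>u\<^sub>,\<^sub>1\<close>.
\<close>

primrec char_letter :: "letter \<Rightarrow> laurent" where
  "char_letter Ls = par Us1"
| "char_letter Lt = par Ut1"
| "char_letter Lu = par Uu1"

definition char_word :: "word \<Rightarrow> laurent" where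
  "char_word w = prod_list (map char_letter (letters w))"

definition lin_char :: "free_alg \<Rightarrow> laurent" where
  "lin_char f = (\<Sum>w\<in>Poly_Mapping.keys f. Poly_Mapping.lookup f w * char_word w)"

lemma char_word_zero: "char_word 0 = 1"
  by (simp add: char_word_def zero_word_def)

lemma char_word_add: "char_word (v + w) = char_word v * char_word w"
  by (simp add: char_word_def plus_word_def)

lemma lin_char_superset:
  assumes "finite K" "Poly_Mapping.keys f \<subseteq> K"
  shows "lin_char f = (\<Sum>w\<in>K. Poly_Mapping.lookup f w * char_word w)"
  unfolding lin_char_def
  using assms by (intro sum.mono_neutral_left) (auto simp: in_keys_iff)

lemma lin_char_single: "lin_char (Poly_Mapping.single w c) = c * char_word w"
  by (subst lin_char_superset[of "{w}"]) auto

lemma lin_char_zero: "lin_char 0 = 0"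
  by (simp add: lin_char_def)

lemma lin_char_add: "lin_char (f + g) = lin_char f + lin_char g"
proof -
  let ?K = "Poly_Mapping.keys f \<union> Poly_Mapping.keys g"
  have "Poly_Mapping.keys (f + g) \<subseteq> ?K"
    by (rule keys_add)
  then show ?thesis
    by (simp add: lin_char_superset[of ?K] lookup_add distrib_right sum.distrib)
qed

lemma lin_char_uminus: "lin_char (- f) = - lin_char f"
  using lin_char_add[of f "- f"] by (simp add: lin_char_zero eq_neg_iff_add_eq_0 add.commute)

lemma lin_char_diff: "lin_char (f - g) = lin_char f - lin_char g"
  using lin_char_add[of f "- g"] by (simp add: lin_char_uminus)

lemma lin_char_sum: "lin_char (sum h A) = (\<Sum>a\<in>A. lin_char (h a))"
  by (induction A rule: infinite_finite_induct) (simp_all add: lin_char_zero lin_char_add)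

lemma lin_char_mult: "lin_char (f * g) = lin_char f * lin_char g"
proof -
  have "lin_char ((\<Sum>v\<in>A. Poly_Mapping.single v (a v)) * (\<Sum>w\<in>B. Poly_Mapping.single w (b w))) =
    lin_char (\<Sum>v\<in>A. Poly_Mapping.single v (a v)) * lin_char (\<Sum>w\<in>B. Poly_Mapping.single w (b w))"
    for A B a b
    by (simp add: sum_product lin_char_sum mult_single lin_char_single char_word_add mult_ac)
  from this[where A = "Poly_Mapping.keys f" and a = "Poly_Mapping.lookup f"
      and B = "Poly_Mapping.keys g" and b = "Poly_Mapping.lookup g"] show ?thesis
    by (simp only: sum_singles[symmetric])
qed

lemma lin_char_one: "lin_char 1 = 1"
  using lin_char_single[of 0 1] by (simp add: char_word_zero)

lemma lin_char_fconst: "lin_char (fconst c) = c"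
  by (simp add: fconst_def lin_char_single char_word_zero)

lemma lin_char_fgen: "lin_char (fgen l) = char_letter l"
  by (simp add: fgen_def lin_char_single char_word_def)

lemma lin_char_hecke_ideal: "x \<in> hecke_ideal \<Longrightarrow> lin_char x = 0"
proof -
  have "hecke_ideal \<subseteq> {x. lin_char x = 0}"
    unfolding hecke_ideal_def
    by (rule hull_minimal)
      (auto simp: two_sided_ideal_def hecke_relators_def Let_def lin_char_zero lin_char_add
        lin_char_diff lin_char_mult lin_char_fconst lin_char_fgen)
  then show "x \<in> hecke_ideal \<Longrightarrow> lin_char x = 0"
    by auto
qed

lemma one_notin_hecke_ideal: "1 \<notin> hecke_ideal"
  using lin_char_hecke_ideal lin_char_one by fastforce

subsection \<open>The quotient algebra\<close>

definition hecke_rel :: "free_alg \<Rightarrow> free_alg \<Rightarrow> bool" where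
  "hecke_rel x y \<longleftrightarrow> x - y \<in> hecke_ideal"

quotient_type hecke_G15 = free_alg / hecke_rel
  unfolding hecke_rel_def by (rule ideal_equivp[OF two_sided_ideal_hecke_ideal])

instantiation hecke_G15 :: ring_1
begin

lift_definition zero_hecke_G15 :: hecke_G15 is 0 .

lift_definition one_hecke_G15 :: hecke_G15 is 1 .

lift_definition plus_hecke_G15 :: "hecke_G15 \<Rightarrow> hecke_G15 \<Rightarrow> hecke_G15" is "(+)"
  unfolding hecke_rel_def by (rule ideal_cong_add[OF two_sided_ideal_hecke_ideal])

lift_definition minus_hecke_G15 :: "hecke_G15 \<Rightarrow> hecke_G15 \<Rightarrow> hecke_G15" is "(-)"
  unfolding hecke_rel_def by (rule ideal_cong_diff[OF two_sided_ideal_hecke_ideal])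

lift_definition uminus_hecke_G15 :: "hecke_G15 \<Rightarrow> hecke_G15" is uminus
  unfolding hecke_rel_def by (rule ideal_cong_uminus[OF two_sided_ideal_hecke_ideal])

lift_definition times_hecke_G15 :: "hecke_G15 \<Rightarrow> hecke_G15 \<Rightarrow> hecke_G15" is "(*)"
  unfolding hecke_rel_def by (rule ideal_cong_mult[OF two_sided_ideal_hecke_ideal])

instance
proof
  show "(0::hecke_G15) \<noteq> 1"
    using one_notin_hecke_ideal ideal_uminus[OF two_sided_ideal_hecke_ideal, of "- 1"]
    by transfer (auto simp: hecke_rel_def)
qed (transfer, simp add: hecke_rel_def algebra_simps ideal_zero[OF two_sided_ideal_hecke_ideal])+

end

lift_definition hconst :: "laurent \<Rightarrow> hecke_G15" is fconst .

definition hscale :: "laurent \<Rightarrow> hecke_G15 \<Rightarrow> hecke_G15" where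
  "hscale c x = hconst c * x"

lemma hconst_add: "hconst (a + b) = hconst a + hconst b"
  by transfer (simp add: hecke_rel_def fconst_add ideal_zero[OF two_sided_ideal_hecke_ideal])

lemma hconst_mult: "hconst (a * b) = hconst a * hconst b"
  by transfer (simp add: hecke_rel_def fconst_mult ideal_zero[OF two_sided_ideal_hecke_ideal])

lemma hconst_one: "hconst 1 = 1"
  by transfer (simp add: hecke_rel_def fconst_one ideal_zero[OF two_sided_ideal_hecke_ideal])

lemma hconst_central: "hconst c * x = x * hconst c"
  by transfer (simp add: hecke_rel_def fconst_central ideal_zero[OF two_sided_ideal_hecke_ideal])

interpretation hecke: module hscale
  by standard (simp_all add: hscale_def hconst_add hconst_mult hconst_one algebra_simps)

lemma hscale_mult_left: "hscale c x * y = hscale c (x * y)"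
  by (simp add: hscale_def mult.assoc)

lemma hscale_mult_right: "x * hscale c y = hscale c (x * y)"
  by (metis hscale_def hconst_central mult.assoc)

lift_definition hs :: hecke_G15 is "fgen Ls" .

lift_definition ht :: hecke_G15 is "fgen Lt" .

lift_definition hu :: hecke_G15 is "fgen Lu" .

lemma hecke_relator: "x \<in> hecke_relators \<Longrightarrow> hecke_rel x 0"
  using hull_subset[of hecke_relators two_sided_ideal] by (auto simp: hecke_rel_def hecke_ideal_def)

lemma hecke_braid1: "hs * ht * hu = ht * hu * hs"
  using hull_subset[of hecke_relators two_sided_ideal]
  by transfer (simp add: hecke_rel_def hecke_ideal_def hecke_relators_def Let_def)

lemma hecke_braid2: "hu * hs * ht * hu * ht = hs * ht * hu * ht * hu"
  using hull_subset[of hecke_relators two_sided_ideal]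
  by transfer (simp add: hecke_rel_def hecke_ideal_def hecke_relators_def Let_def)

lemma hecke_quadratic_s: "(hs - hconst (par Us1)) * (hs - hconst (par Us2)) = 0"
  by transfer (rule hecke_relator, simp add: hecke_relators_def Let_def)

lemma hecke_quadratic_t: "(ht - hconst (par Ut1)) * (ht - hconst (par Ut2)) = 0"
  by transfer (rule hecke_relator, simp add: hecke_relators_def Let_def)

lemma hecke_cubic_u:
  "(hu - hconst (par Uu1)) * (hu - hconst (par Uu2)) * (hu - hconst (par Uu3)) = 0"
  by transfer (rule hecke_relator, simp add: hecke_relators_def Let_def)


section \<open>Subalgebras, products of subsets, and the submodule \<open>U\<close>\<close>

definition hsubalgebra :: "hecke_G15 set \<Rightarrow> bool" where
  "hsubalgebra A \<longleftrightarrow> hecke.subspace A \<and> 1 \<in> A \<and> (\<forall>x\<in>A. \<forall>y\<in>A. x * y \<in> A)"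

definition u1 :: "hecke_G15 set" where
  "u1 = hsubalgebra hull {hs}"

definition u2 :: "hecke_G15 set" where
  "u2 = hsubalgebra hull {ht}"

definition u3 :: "hecke_G15 set" where
  "u3 = hsubalgebra hull {hu}"

text \<open>
  The product of subsets is the \<^typ>\<open>laurent\<close>-submodule spanned by the elementwise products. It is
  associative, so that the bracketing of iterated products is immaterial.
\<close>

definition set_mult :: "hecke_G15 set \<Rightarrow> hecke_G15 set \<Rightarrow> hecke_G15 set"  (infixl \<open>\<star>\<close> 70) where
  "X \<star> Y = hecke.span {x * y | x y. x \<in> X \<and> y \<in> Y}"

definition hz :: hecke_G15 where
  "hz = hs * ht * hu * ht * hu"

definition U :: "hecke_G15 set" where
  "U = {\<Sum>k\<in>{0..11}. f k | f :: nat \<Rightarrow> hecke_G15.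
          \<forall>k\<in>{0..11}. f k \<in> {hz ^ k} \<star> u3 \<star> u2 \<star> u1 \<star> u2 \<star> u1}"

end

theory Submission
  imports Defs
begin

text \<open>
  Since \<open>s\<close> commutes with \<open>p = tu\<close> and \<open>z = sp\<^sup>2\<close> is central, the braid group of \<open>G\<^sub>1\<^sub>5\<close> is the
  direct product of the infinite cyclic group generated by \<open>z\<close> and the free group on \<open>t\<close> and \<open>u\<close>,
  with \<open>s = zp\<^sup>-\<^sup>2\<close>. The quadratic relations allow one to move along a line \<open>gt\<^sup>ih\<close> or \<open>gs\<^sup>ih\<close>:
  if two consecutive points lie in a submodule, then so do their neighbours, because the outer
  coefficients of the relation are units. The cubic relation does the same for three consecutive
  points of \<open>gu\<^sup>ih\<close>.

  By construction \<open>U\<close> is stable under left multiplication by \<open>u\<close> and right multiplication by \<open>s\<close>.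
  Up to these, moves along lines lead from \<open>z\<^sup>k\<close>, \<open>z\<^sup>kt\<close>, \<open>z\<^sup>kst\<close>, \<open>z\<^sup>ktst\<close> with \<open>0 \<le> k \<le> 11\<close> to
  \<open>z\<^sup>kstst\<close> and \<open>z\<^sup>ktstst\<close> in the same range of exponents, so \<open>U\<close> is stable under right
  multiplication by \<open>t\<close>. With this additional freedom, lines lead from the \<open>z\<^sup>k\<close> to \<open>z\<^sup>ktu\<^sup>i\<close> and
  \<open>z\<^sup>ksu\<^sup>i\<close>, and \<open>U\<close> is a left ideal containing \<open>1\<close>.
\<close>

section \<open>Units of the Hecke algebra\<close>

text \<open>Induction principle for the quotient: each class is a finite sum of classes of
  monomials, and those lie in any subalgebra containing the three letters. It is applied to the
  centralizer of \<open>hz\<close> and to the left stabilizer of \<open>U\<close>.\<close>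

lemma hecke_G15_generated:
  assumes A: "hsubalgebra A" and "hs \<in> A" "ht \<in> A" "hu \<in> A"
  shows "x \<in> A"
proof -
  have sub: "hecke.subspace A" and one: "1 \<in> A" and mult: "\<And>x y. x \<in> A \<Longrightarrow> y \<in> A \<Longrightarrow> x * y \<in> A"
    using A by (auto simp: hsubalgebra_def)
  have const: "hconst c \<in> A" for c
    using hecke.subspace_scale[OF sub one, of c] by (simp add: hscale_def)
  have gen: "abs_hecke_G15 (fgen l) \<in> A" for l
    using assms(2-4) by (cases l) (simp_all add: hs_def ht_def hu_def)
  have word: "abs_hecke_G15 (Poly_Mapping.single (Word l) c) \<in> A" for l c
  proof (induction l)
    case Nil
    show ?case
      using const[of c] by (simp add: hconst_def fconst_def zero_word_def)
  next
    case (Cons a l)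
    have "Poly_Mapping.single (Word (a # l)) c = fgen a * Poly_Mapping.single (Word l) c"
      by (simp add: fgen_def mult_single plus_word_def)
    then have "abs_hecke_G15 (Poly_Mapping.single (Word (a # l)) c) =
        abs_hecke_G15 (fgen a) * abs_hecke_G15 (Poly_Mapping.single (Word l) c)"
      by (simp add: times_hecke_G15.abs_eq)
    then show ?case
      using mult[OF gen Cons] by simp
  qed
  have sum: "abs_hecke_G15 (\<Sum>w\<in>K. Poly_Mapping.single w (g w)) \<in> A" for K :: "word set" and g
  proof (induction K rule: infinite_finite_induct)
    case (insert w K)
    have "abs_hecke_G15 (Poly_Mapping.single w (g w)) \<in> A"
      using word[of "letters w" "g w"] by simp
    then show ?case
      using insert hecke.subspace_add[OF sub] by (simp flip: plus_hecke_G15.abs_eq)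
  qed (use hecke.subspace_0[OF sub] in \<open>simp_all flip: zero_hecke_G15.abs_eq\<close>)
  obtain f where "x = abs_hecke_G15 f"
    by (metis Quotient_hecke_G15 Quotient_abs_rep)
  then show ?thesis
    using sum sum_singles[of f] by metis
qed

section \<open>Centrality of \<open>z\<close>\<close>

lemma z_eq: "hz = hu * hs * ht * hu * ht"
  by (simp add: hz_def hecke_braid2)

text \<open>\<open>hs\<close> commutes with \<open>ht * hu\<close>, and \<open>hz\<close> is
  \<open>hs\<close> times the square of that product. For \<open>ht\<close> and \<open>hu\<close>
  the two expressions of \<open>hz\<close> given by the second braid relation are compared.\<close>

lemma z_commutes_gens: "hz * hs = hs * hz" "hz * ht = ht * hz" "hz * hu = hu * hz"
proof -
  have b1: "hs * (ht * hu) = ht * (hu * hs)" and b1': "hs * (ht * (hu * x)) = ht * (hu * (hs * x))" for x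
    using hecke_braid1 by (simp_all flip: mult.assoc)
  show "hz * hs = hs * hz"
    using hecke_braid1 by (simp add: hz_def mult.assoc b1 b1')
  have "hz * ht = hs * ht * hu * ht * hu * ht"
    by (simp add: hz_def)
  also have "\<dots> = ht * hz"
    by (simp add: z_eq hecke_braid1 flip: mult.assoc)
  finally show "hz * ht = ht * hz" .
  have "hu * hz = hu * hs * ht * hu * ht * hu"
    by (simp add: hz_def flip: mult.assoc)
  then show "hz * hu = hu * hz"
    by (simp add: z_eq)
qed

lemma z_central: "hz * x = x * hz"
proof -
  have "x \<in> {x. hz * x = x * hz}"
  proof (rule hecke_G15_generated)
    show "hsubalgebra {x. hz * x = x * hz}"
      by (auto simp: hsubalgebra_def hecke.subspace_def distrib_left distrib_right
          hscale_mult_left hscale_mult_right) (metis mult.assoc)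
  qed (use z_commutes_gens in auto)
  then show ?thesis
    by simp
qed

section \<open>Inverses from the quadratic and cubic relations\<close>

lemma hconst_eq_scale: "hconst c = hscale c 1"
  by (simp add: hscale_def)

text \<open>The constant term \<open>a * b\<close> is a unit with inverse \<open>q\<close>, so the
  relation can be solved for \<open>1\<close>. Both linear relations are kept because lines are
  followed in both directions.\<close>

lemma quadratic_unit:
  assumes "(x - hconst a) * (x - hconst b) = 0" "a * a' = 1" "b * b' = 1"
  obtains y c d c' d' where "x * y = 1" "y * x = 1"
    "x = hscale c y + hscale d 1" "y = hscale c' x + hscale d' 1"
proof -
  define q where "q = a' * b'"
  have q: "q * (a * b) = 1"
    using assms(2,3) unfolding q_def by (metis mult.commute mult.left_commute mult.right_neutral)
  define y where "y = hscale (- q) x + hscale (q * (a + b)) 1"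
  have xx: "x * x = hscale (a + b) x - hscale (a * b) 1"
    using assms(1)
    by (simp add: hconst_eq_scale algebra_simps hscale_mult_left hscale_mult_right
        hecke.scale_left_distrib)
  have "x * y = hscale (- q) (x * x) + hscale (q * (a + b)) x"
    by (simp add: y_def distrib_left right_diff_distrib hscale_mult_right)
  also have "\<dots> = hscale (q * (a * b)) 1"
    by (simp add: xx hecke.scale_right_diff_distrib)
  finally have xy: "x * y = 1"
    by (simp add: q)
  have "y * x = x * y"
    unfolding y_def distrib_left distrib_right hscale_mult_left hscale_mult_right by simp
  moreover have "x = hscale (- (a * b)) y + hscale (a + b) 1"
  proof -
    have abq: "a * b * q = 1"
      by (subst mult.commute) (rule q)
    moreover have "a * b * (q * (a + b)) = a + b"
      by (simp only: mult.assoc[symmetric] abq mult_1_left)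
    ultimately have "- (a * b) * - q = 1" "- (a * b) * (q * (a + b)) = - (a + b)"
      by (simp_all only: minus_mult_minus mult_minus_left mult_minus_right minus_minus)
    then have "hscale (- (a * b)) y = x + hscale (- (a + b)) 1"
      by (simp only: y_def hecke.scale_right_distrib hecke.scale_scale hecke.scale_one)
    then show ?thesis
      by (simp only: hecke.scale_minus_left) simp
  qed
  ultimately show ?thesis
    using that xy y_def by metis
qed

text \<open>As the constant term \<open>e3\<close> is a unit, the cubic can be solved for
  \<open>1\<close> and for either end of four consecutive powers. The last two relations continue a
  line past \<open>x\<close> and past \<open>y\<close>.\<close>

lemma cubic_unit:
  assumes "(x - hconst a) * (x - hconst b) * (x - hconst c) = 0" "a * a' = 1" "b * b' = 1" "c * c' = 1"
  obtains y l m n d e f d' e' f' where "x * y = 1" "y * x = 1"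
    "y = hscale l (x * x) + hscale m x + hscale n 1"
    "x * x = hscale d x + hscale e 1 + hscale f y"
    "y * y = hscale d' y + hscale e' 1 + hscale f' x"
proof -
  define e1 e2 e3 q where "e1 = a + b + c" and "e2 = a * b + a * c + b * c" and "e3 = a * b * c"
    and "q = a' * b' * c'"
  have q: "q * e3 = 1"
  proof -
    have "q * e3 = (a * a') * (b * b') * (c * c')"
      by (simp add: q_def e3_def mult_ac)
    then show ?thesis
      by (simp add: assms)
  qed
  define y where "y = hscale q (x * x) + hscale (- q * e1) x + hscale (q * e2) 1"
  have xxx: "x * (x * x) = hscale e1 (x * x) - hscale e2 x + hscale e3 1"
    using assms(1)
    by (simp add: e1_def e2_def e3_def hconst_eq_scale algebra_simps hscale_mult_left
        hscale_mult_right hecke.scale_left_distrib hecke.scale_right_distrib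
        hecke.scale_right_diff_distrib)
  have "x * y = hscale q (x * (x * x)) + hscale (- q * e1) (x * x) + hscale (q * e2) x"
    by (simp add: y_def distrib_left right_diff_distrib hscale_mult_right)
  also have "\<dots> = hscale (q * e3) 1"
    by (simp add: xxx hecke.scale_right_diff_distrib hecke.scale_right_distrib)
  finally have xy: "x * y = 1"
    by (simp add: q)
  have yx: "y * x = 1"
  proof -
    have "y * x = x * y"
      unfolding y_def distrib_left distrib_right hscale_mult_left hscale_mult_right mult.assoc
      by simp
    then show ?thesis
      by (simp add: xy)
  qed
  have xx: "x * x = hscale e1 x + hscale (- e2) 1 + hscale e3 y"
  proof -
    have "e3 * q = 1" "e3 * (q * e) = e" for e
      using q by (metis mult.commute, metis mult.assoc mult.commute mult.left_neutral)
    then show ?thesis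
      by (simp add: y_def hecke.scale_right_distrib hecke.scale_right_diff_distrib)
  qed
  \<comment> \<open>Multiplying the definition of \<open>y\<close> by \<open>y\<close> lowers each
    power of \<open>x\<close> by one.\<close>
  have "y * y = hscale q (x * x * y) + hscale (- q * e1) (x * y) + hscale (q * e2) y"
    by (subst (1) y_def) (simp add: distrib_right left_diff_distrib hscale_mult_left)
  also have "\<dots> = hscale (q * e2) y + hscale (- q * e1) 1 + hscale q x"
    by (simp add: mult.assoc xy)
  finally show ?thesis
    using that xy yx y_def xx by blast
qed

text \<open>A choice, hence meaningful only for units; there the two-sided inverse is unique, so
  \<open>hinv_eqI\<close> determines the value.\<close>

definition hinv :: "hecke_G15 \<Rightarrow> hecke_G15" where
  "hinv x = (SOME y. x * y = 1 \<and> y * x = 1)"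

lemma hinv_eqI: "x * y = 1 \<Longrightarrow> y * x = 1 \<Longrightarrow> hinv x = y"
  unfolding hinv_def by (rule some_equality) (auto, metis mult.assoc mult.right_neutral mult.left_neutral)

lemma t_inverse: "ht * hinv ht = 1" "hinv ht * ht = 1"
  and t_span: "\<exists>c d. ht = hscale c (hinv ht) + hscale d 1"
  and t_inverse_span: "\<exists>c d. hinv ht = hscale c ht + hscale d 1"
  by (rule quadratic_unit[OF hecke_quadratic_t par_invertible par_invertible], metis hinv_eqI)+

lemma s_inverse: "hs * hinv hs = 1" "hinv hs * hs = 1"
  and s_span: "\<exists>c d. hs = hscale c (hinv hs) + hscale d 1"
  and s_inverse_span: "\<exists>c d. hinv hs = hscale c hs + hscale d 1"
  by (rule quadratic_unit[OF hecke_quadratic_s par_invertible par_invertible], metis hinv_eqI)+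

lemma u_inverse: "hu * hinv hu = 1" "hinv hu * hu = 1"
  and u_inverse_span: "\<exists>c d e. hinv hu = hscale c (hu * hu) + hscale d hu + hscale e 1"
  and u_square_span: "\<exists>c d e. hu * hu = hscale c hu + hscale d 1 + hscale e (hinv hu)"
  and u_inverse_square_span: "\<exists>c d e. hinv hu * hinv hu = hscale c (hinv hu) + hscale d 1 + hscale e hu"
  by (rule cubic_unit[OF hecke_cubic_u par_invertible par_invertible par_invertible], metis hinv_eqI)+

lemma z_inverse: "hz * hinv hz = 1" "hinv hz * hz = 1"
proof -
  define y where "y = hinv hu * (hinv ht * (hinv hu * (hinv ht * hinv hs)))"
  have cancel: "x * hinv x = 1 \<Longrightarrow> x * (hinv x * w) = w" "hinv x * x = 1 \<Longrightarrow> hinv x * (x * w) = w" for x w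
    by (simp_all flip: mult.assoc)
  have "hz * y = 1" "y * hz = 1"
    by (simp_all add: hz_def y_def mult.assoc cancel t_inverse s_inverse u_inverse)
  then show "hz * hinv hz = 1" "hinv hz * hz = 1"
    using hinv_eqI by metis+
qed

section \<open>Integral powers of \<open>z\<close>; negative ones arise when \<open>hinv hs\<close>
  is eliminated\<close>

definition zpow :: "int \<Rightarrow> hecke_G15" where
  "zpow k = (if k \<ge> 0 then hz ^ nat k else hinv hz ^ nat (- k))"

lemma zpow_add_one: "zpow (k + 1) = hz * zpow k"
proof (cases "k \<ge> 0")
  case True
  then show ?thesis
    by (simp add: zpow_def nat_add_distrib)
next
  case False
  then have "nat (- k) = Suc (nat (- (k + 1)))"
    by simp
  then have "hz * zpow k = hz * (hinv hz * hinv hz ^ nat (- (k + 1)))"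
    using False by (simp add: zpow_def)
  also have "\<dots> = hinv hz ^ nat (- (k + 1))"
    by (simp add: z_inverse flip: mult.assoc)
  finally show ?thesis
    using False by (auto simp: zpow_def)
qed

lemma zpow_diff_one: "zpow (k - 1) = hinv hz * zpow k"
  using zpow_add_one[of "k - 1"] by (simp add: z_inverse flip: mult.assoc)

lemma zpow_add: "zpow (j + k) = zpow j * zpow k"
proof (induction j rule: int_induct[of _ 0])
  case base
  show ?case
    by (simp add: zpow_def)
next
  case (step1 i)
  then show ?case
    by (metis zpow_add_one add.assoc add.commute mult.assoc)
next
  case (step2 i)
  then show ?case
    by (metis zpow_diff_one add_diff_eq add.commute mult.assoc)
qed

lemma zpow_simps [simp]: "zpow 0 = 1" "zpow 1 = hz" "zpow (- 1) = hinv hz"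
  by (simp_all add: zpow_def)

lemma zpow_of_nat: "zpow (int k) = hz ^ k"
  by (simp add: zpow_def)

lemma hinv_z_central: "hinv hz * x = x * hinv hz"
  by (metis z_central z_inverse mult.assoc mult.left_neutral mult.right_neutral)

lemma zpow_central: "zpow k * x = x * zpow k"
proof (induction k rule: int_induct[of _ 0])
  case (step1 i)
  then show ?case
    by (metis zpow_add_one z_central mult.assoc)
next
  case (step2 i)
  then show ?case
    by (metis zpow_diff_one hinv_z_central mult.assoc)
qed simp

section \<open>Words and lines\<close>

text \<open>
  All other characters denote \<open>1\<close>, so that the identities below need no assumption on the characters.
\<close>

definition gen :: "char \<Rightarrow> hecke_G15" where
  "gen c = (if c = CHR ''t'' then ht else if c = CHR ''T'' then hinv ht
    else if c = CHR ''u'' then hu else if c = CHR ''U'' then hinv hu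
    else if c = CHR ''s'' then hs else if c = CHR ''S'' then hinv hs else 1)"

definition opp :: "char \<Rightarrow> char" where
  "opp c = (if c = CHR ''t'' then CHR ''T'' else if c = CHR ''T'' then CHR ''t''
    else if c = CHR ''u'' then CHR ''U'' else if c = CHR ''U'' then CHR ''u''
    else if c = CHR ''s'' then CHR ''S'' else if c = CHR ''S'' then CHR ''s'' else c)"

lemma gen_opp: "gen c * gen (opp c) = 1"
  by (simp add: gen_def opp_def t_inverse s_inverse u_inverse)

lemma gen_opp_span:
  assumes "c \<noteq> CHR ''u''" "c \<noteq> CHR ''U''"
  shows "\<exists>a b. gen (opp c) = hscale a (gen c) + hscale b 1"
proof -
  consider "c = CHR ''t''" | "c = CHR ''T''" | "c = CHR ''s''" | "c = CHR ''S''" | "opp c = c"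
    using assms unfolding opp_def by presburger
  then show ?thesis
  proof cases
    case 5
    then have "gen (opp c) = hscale 1 (gen c) + hscale 0 1"
      by simp
    then show ?thesis
      by blast
  qed (simp_all add: gen_def opp_def t_span t_inverse_span s_span s_inverse_span)
qed

lemma gen_square_span:
  assumes "c = CHR ''u'' \<or> c = CHR ''U''"
  shows "\<exists>a b d. gen c * gen c = hscale a (gen c) + hscale b 1 + hscale d (gen (opp c))"
  using assms u_square_span u_inverse_square_span by (auto simp: gen_def opp_def)

section \<open>Words, free reduction and elimination of \<open>s\<close>\<close>

primrec hword :: "string \<Rightarrow> hecke_G15" where
  "hword [] = 1"
| "hword (c # w) = gen c * hword w"

lemma hword_append: "hword (v @ w) = hword v * hword w"
  by (induction v) (simp_all add: mult.assoc)

text \<open>A character fixed by \<open>opp\<close> cancels against itself, which is sound because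
  it denotes \<open>1\<close>.\<close>

fun reduce :: "string \<Rightarrow> string" where
  "reduce [] = []"
| "reduce (c # w) = (case reduce w of [] \<Rightarrow> [c] | d # v \<Rightarrow> if d = opp c then v else c # d # v)"

lemma hword_reduce: "hword (reduce w) = hword w"
proof (induction w)
  case (Cons c w)
  show ?case
  proof (cases "reduce w")
    case (Cons d v)
    then have "hword w = gen d * hword v"
      using Cons.IH by simp
    then show ?thesis
      using Cons by (auto simp: gen_opp mult.assoc[symmetric])
  qed (use Cons in simp)
qed simp

lemma hword_s: "hs = hz * hword ''UTUT''" "hinv hs = hinv hz * hword ''tutu''"
proof -
  have cancel: "x * hinv x = 1 \<Longrightarrow> x * (hinv x * w) = w" "hinv x * x = 1 \<Longrightarrow> hinv x * (x * w) = w" for x w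
    by (simp_all flip: mult.assoc)
  show *: "hs = hz * hword ''UTUT''"
    by (simp add: gen_def hz_def mult.assoc cancel t_inverse u_inverse)
  have "hs * hword ''tutu'' = hz"
    by (simp add: gen_def hz_def mult.assoc)
  then show "hinv hs = hinv hz * hword ''tutu''"
    by (metis hinv_z_central mult.assoc mult.left_neutral mult.right_neutral s_inverse(2) z_inverse(1))
qed

definition expand :: "char \<Rightarrow> int \<times> string" where
  "expand c = (if c = CHR ''s'' then (1, ''UTUT'') else if c = CHR ''S'' then (- 1, ''tutu'') else (0, [c]))"

lemma expand: "expand c = (e, v) \<Longrightarrow> zpow e * hword v = gen c"
  using hword_s by (auto simp: expand_def gen_def split: if_splits)

text \<open>
  A tail rule \<open>(x, y, d)\<close> trades the suffix \<open>x\<close> of a word for \<open>y\<close> and a factor \<open>z\<^sup>d\<close>. The two sides agree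
  up to a right factor under which the submodule in question is stable.
\<close>

type_synonym tail_rule = "string \<times> string \<times> int"

text \<open>Truncated subtraction does no harm: if \<open>x\<close> is longer than \<open>w\<close>,
  then \<open>drop n w\<close> is \<open>w\<close>, which differs from \<open>x\<close> in
  length.\<close>

fun rewrite_tail :: "tail_rule list \<Rightarrow> int \<times> string \<Rightarrow> int \<times> string" where
  "rewrite_tail [] p = p"
| "rewrite_tail ((x, y, d) # rs) (k, w) = rewrite_tail rs
    (let n = length w - length x in if drop n w = x then (k + d, take n w @ y) else (k, w))"

text \<open>Leading \<open>u\<close> and \<open>U\<close> are dropped because the submodule in
  question is stable under left multiplication by powers of \<open>hu\<close>.\<close>

fun normalize_step :: "tail_rule list \<Rightarrow> int \<times> string \<Rightarrow> int \<times> string" where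
  "normalize_step rs (k, w) =
    rewrite_tail rs (k, dropWhile (\<lambda>c. c = CHR ''u'' \<or> c = CHR ''U'') (reduce w))"

primrec iterate_step :: "nat \<Rightarrow> tail_rule list \<Rightarrow> int \<times> string \<Rightarrow> int \<times> string" where
  "iterate_step 0 rs p = p"
| "iterate_step (Suc n) rs p = iterate_step n rs (normalize_step rs p)"

text \<open>
  Three rounds suffice for the tables below; the soundness proof works for any number of rounds.
\<close>

definition normalize :: "tail_rule list \<Rightarrow> int \<times> string \<Rightarrow> int \<times> string" where
  "normalize = iterate_step 3"

lemma rewrite_tail_shift: "rewrite_tail rs (k + fst p, snd p) = apfst ((+) k) (rewrite_tail rs p)"
proof (induction rs p rule: rewrite_tail.induct)
  case (1 p)
  show ?case
    by (cases p) simp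
next
  case (2 x y d rs l w)
  then show ?case
    by (cases "drop (length w - length x) w = x") (simp_all add: Let_def add.assoc)
qed

text \<open>No branch inspects the exponent, so a single normalization serves a whole interval of
  exponents.\<close>

lemma normalize_shift: "normalize rs (k + e, w) = apfst ((+) k) (normalize rs (e, w))"
proof -
  have step: "normalize_step rs (apfst ((+) k) p) = apfst ((+) k) (normalize_step rs p)" for p
    by (cases p) (simp flip: rewrite_tail_shift)
  have "iterate_step n rs (apfst ((+) k) p) = apfst ((+) k) (iterate_step n rs p)" for n p
    by (induction n arbitrary: p) (simp_all add: step)
  from this[of 3 "(e, w)"] show ?thesis
    by (simp add: normalize_def)
qed

text \<open>The fact \<open>(w, a, b)\<close> asserts that \<open>z\<^sup>kw\<close> lies in the submodule for \<open>a \<le> k \<le> b\<close>.\<close>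

type_synonym fact = "string \<times> int \<times> int"

fun prepend_if :: "bool \<Rightarrow> 'a \<Rightarrow> 'a list \<Rightarrow> 'a list" where
  "prepend_if True x xs = x # xs"
| "prepend_if False x xs = xs"

fun intervals :: "fact list \<Rightarrow> string \<Rightarrow> (int \<times> int) list" where
  "intervals [] w = []"
| "intervals ((v, r) # fs) w = prepend_if (v = w) r (intervals fs w)"

text \<open>Checked exponent by exponent, so that several intervals may cover the range
  jointly.\<close>

definition covers :: "(int \<times> int) list \<Rightarrow> int \<Rightarrow> int \<Rightarrow> bool" where
  "covers rs l u = list_all (\<lambda>k. list_ex (\<lambda>r. fst r \<le> k \<and> k \<le> snd r) rs) [l..u]"

fun subsumed :: "fact list \<Rightarrow> fact list \<Rightarrow> bool" where
  "subsumed fs [] = True"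
| "subsumed fs ((w, l, u) # gs) = (covers (intervals fs w) l u \<and> subsumed fs gs)"

definition line :: "char \<Rightarrow> (int \<times> string) list \<times> (int \<times> string)" where
  "line c = (if c = CHR ''u'' \<or> c = CHR ''U'' then ([(0, []), (0, [c]), (0, [opp c])], (0, [c, c]))
     else ([(0, []), expand c], expand (opp c)))"

text \<open>
  The row \<open>(c, g, h, a, b)\<close> is a move along the line \<open>gc\<^sup>ih\<close>. If \<open>c\<close> is \<open>u\<^sup>\<plusminus>\<^sup>1\<close>, it leads from the points
  \<open>i = -1, 0, 1\<close> to \<open>i = 2\<close>, otherwise from \<open>i = 0, 1\<close> to \<open>i = -1\<close>. The bounds \<open>a\<close> and \<open>b\<close> refer
  to the exponent of \<open>z\<close> in the normal form of the new point.
\<close>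

type_synonym row = "char \<times> string \<times> string \<times> int \<times> int"

text \<open>If \<open>k\<close> parametrizes the line, the new point has normal exponent
  \<open>k + d\<close>, so \<open>k\<close> runs from \<open>a - d\<close> to \<open>b - d\<close>.
  This explains the shift by \<open>e - d\<close> for a premise of normal exponent
  \<open>k + e\<close>.\<close>

fun row_facts :: "tail_rule list \<Rightarrow> row \<Rightarrow> fact list \<times> fact" where
  "row_facts rs (c, g, h, a, b) =
    (let place = (\<lambda>(e, v). normalize rs (e, g @ v @ h)); (d, w) = place (snd (line c)) in
      (map (\<lambda>p. let (e, v) = place p in (v, a + e - d, b + e - d)) (fst (line c)), (w, a, b)))"

text \<open>A row with uncovered premises is skipped. Hence soundness does not rest on the tables; a
  faulty table can only make the final check fail.\<close>

fun extend :: "fact list \<Rightarrow> fact list \<times> fact \<Rightarrow> fact list" where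
  "extend fs (gs, f) = prepend_if (subsumed fs gs) f fs"

fun saturate :: "tail_rule list \<Rightarrow> row list \<Rightarrow> fact list \<Rightarrow> fact list" where
  "saturate rs [] fs = fs"
| "saturate rs (r # rows) fs = saturate rs rows (extend fs (row_facts rs r))"

primrec unfold :: "string \<Rightarrow> int \<times> string" where
  "unfold [] = (0, [])"
| "unfold (c # w) = (let (e, v) = expand c; (d, x) = unfold w in (e + d, v @ x))"

lemma hword_unfold: "zpow (fst (unfold w)) * hword (snd (unfold w)) = hword w"
proof (induction w)
  case (Cons c w)
  obtain e v where ev: "expand c = (e, v)"
    by fastforce
  obtain d x where dx: "unfold w = (d, x)"
    by fastforce
  have "zpow (e + d) * hword (v @ x) = zpow e * (zpow d * hword v) * hword x"
    by (simp add: zpow_add hword_append mult.assoc)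
  also have "\<dots> = gen c * hword w"
    using Cons expand[OF ev] by (simp add: dx zpow_central[of d] mult.assoc)
       (simp add: mult.assoc[symmetric])
  finally show ?case
    by (simp add: ev dx)
qed simp

text \<open>The range 0 to 11 is that of the exponents in \<open>U\<close>, moved by the shift
  \<open>d\<close> of the normal form.\<close>

definition normal_fact :: "tail_rule list \<Rightarrow> string \<Rightarrow> fact" where
  "normal_fact rs w = (let (d, v) = normalize rs (unfold w) in (v, d, 11 + d))"

definition certifies :: "tail_rule list \<Rightarrow> row list \<Rightarrow> string list \<Rightarrow> string list \<Rightarrow> bool" where
  "certifies rs rows vs ws =
    subsumed (saturate rs rows (map (normal_fact rs) vs)) (map (normal_fact rs) ws)"

section \<open>Soundness of the calculus of facts\<close>

lemma set_prepend_if: "set (prepend_if p x xs) = (if p then insert x (set xs) else set xs)"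
  by (cases p) auto

lemma set_intervals: "set (intervals fs w) = {r. (w, r) \<in> set fs}"
  by (induction fs w rule: intervals.induct) (auto simp: set_prepend_if)

lemma subsumedD:
  assumes "subsumed fs gs" "(w, l, u) \<in> set gs" "l \<le> k" "k \<le> u"
  obtains a b where "(w, a, b) \<in> set fs" "a \<le> k" "k \<le> b"
proof -
  have "covers (intervals fs w) l u"
    using assms(1,2) by (induction fs gs rule: subsumed.induct) auto
  then have "\<forall>k\<in>{l..u}. \<exists>r. (w, r) \<in> set fs \<and> fst r \<le> k \<and> k \<le> snd r"
    by (simp add: covers_def list_all_iff list_ex_iff set_intervals)
  then obtain r where "(w, r) \<in> set fs" "fst r \<le> k" "k \<le> snd r"
    using assms(3,4) by (meson atLeastAtMost_iff)
  then show ?thesis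
    using that[of "fst r" "snd r"] by simp
qed

text \<open>Instantiated twice with \<open>U\<close>: first using right stability under
  \<open>hs\<close>, then also under \<open>ht\<close>. Tail rules are equivalences since premises
  are read off from normal forms while conclusions are put into them.\<close>

locale word_span =
  fixes M :: "hecke_G15 set" and rules :: "tail_rule list"
  assumes subspace: "hecke.subspace M"
    and left_u: "x \<in> M \<Longrightarrow> hu * x \<in> M"
    and tail_rule: "(p, q, d) \<in> set rules \<Longrightarrow>
      zpow k * hword (v @ p) \<in> M \<longleftrightarrow> zpow (k + d) * hword (v @ q) \<in> M"
begin

definition valid :: "fact \<Rightarrow> bool" where
  "valid f \<longleftrightarrow> (\<forall>k\<in>{fst (snd f)..snd (snd f)}. zpow k * hword (fst f) \<in> M)"

lemma combination: "x \<in> M \<Longrightarrow> y \<in> M \<Longrightarrow> hscale c x + hscale d y \<in> M"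
  "x \<in> M \<Longrightarrow> y \<in> M \<Longrightarrow> z \<in> M \<Longrightarrow> hscale c x + hscale d y + hscale e z \<in> M"
  using subspace by (simp_all add: hecke.subspace_add hecke.subspace_scale)

lemma left_u_inverse:
  assumes "x \<in> M" shows "hinv hu * x \<in> M"
proof -
  obtain c d e where eq: "hinv hu = hscale c (hu * hu) + hscale d hu + hscale e 1"
    using u_inverse_span by blast
  have "hinv hu * x = hscale c (hu * (hu * x)) + hscale d (hu * x) + hscale e x"
    by (subst eq) (simp add: distrib_right hscale_mult_left mult.assoc)
  then show ?thesis
    using combination(2) left_u assms by simp
qed

lemma left_u_iff: "hu * x \<in> M \<longleftrightarrow> x \<in> M" "hinv hu * x \<in> M \<longleftrightarrow> x \<in> M"
proof -
  have "hinv hu * (hu * x) = x" "hu * (hinv hu * x) = x"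
    by (simp_all add: u_inverse flip: mult.assoc)
  then show "hu * x \<in> M \<longleftrightarrow> x \<in> M" "hinv hu * x \<in> M \<longleftrightarrow> x \<in> M"
    using left_u[of x] left_u_inverse[of x] left_u[of "hinv hu * x"] left_u_inverse[of "hu * x"]
    by metis+
qed

lemma mem_strip: "zpow k * hword (dropWhile (\<lambda>c. c = CHR ''u'' \<or> c = CHR ''U'') w) \<in> M \<longleftrightarrow> zpow k * hword w \<in> M"
proof (induction w)
  case (Cons c w)
  have eq: "zpow k * hword (c # w) = gen c * (zpow k * hword w)"
    by (simp add: zpow_central[of k "gen c"] flip: mult.assoc)
  show ?case
  proof (cases "c = CHR ''u'' \<or> c = CHR ''U''")
    case True
    then have "gen c * (zpow k * hword w) \<in> M \<longleftrightarrow> zpow k * hword w \<in> M"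
      using left_u_iff[of "zpow k * hword w"] by (auto simp: gen_def)
    then show ?thesis
      using Cons.IH True unfolding eq by simp
  qed auto
qed simp

lemma mem_rewrite_tail:
  assumes "set rs \<subseteq> set rules"
  shows "zpow (fst (rewrite_tail rs p)) * hword (snd (rewrite_tail rs p)) \<in> M \<longleftrightarrow> zpow (fst p) * hword (snd p) \<in> M"
  using assms
proof (induction rs arbitrary: p)
  case (Cons r rs)
  obtain x y d where r: "r = (x, y, d)"
    by (cases r)
  obtain k w where p: "p = (k, w)"
    by (cases p)
  define n where "n = length w - length x"
  define q where "q = (if drop n w = x then (k + d, take n w @ y) else (k, w))"
  have "zpow k * hword (take n w @ x) \<in> M \<longleftrightarrow> zpow (k + d) * hword (take n w @ y) \<in> M"
    using tail_rule[of x y d] Cons.prems r by simp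
  then have "zpow (fst q) * hword (snd q) \<in> M \<longleftrightarrow> zpow k * hword w \<in> M"
    by (cases "drop n w = x") (auto simp: q_def)
  moreover have "rewrite_tail (r # rs) p = rewrite_tail rs q"
    by (simp add: r p q_def n_def Let_def)
  moreover have "set rs \<subseteq> set rules"
    using Cons.prems by simp
  ultimately show ?case
    using Cons.IH[of q] unfolding p fst_conv snd_conv by metis
qed simp

lemma mem_normalize_step:
  "zpow (fst (normalize_step rules p)) * hword (snd (normalize_step rules p)) \<in> M \<longleftrightarrow>
    zpow (fst p) * hword (snd p) \<in> M"
  by (cases p) (simp only: normalize_step.simps mem_rewrite_tail[OF subset_refl] fst_conv snd_conv
      mem_strip hword_reduce)

lemma mem_normalize:
  "zpow (fst (normalize rules p)) * hword (snd (normalize rules p)) \<in> M \<longleftrightarrow>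
    zpow (fst p) * hword (snd p) \<in> M"
proof -
  have "zpow (fst (iterate_step n rules p)) * hword (snd (iterate_step n rules p)) \<in> M \<longleftrightarrow>
      zpow (fst p) * hword (snd p) \<in> M" for n
    by (induction n arbitrary: p) (simp_all only: iterate_step.simps mem_normalize_step)
  then show ?thesis
    unfolding normalize_def .
qed

lemma mem_normalize_shift:
  assumes "normalize rules (e, v) = (d, w)"
  shows "zpow (k + d) * hword w \<in> M \<longleftrightarrow> zpow (k + e) * hword v \<in> M"
  using mem_normalize[of "(k + e, v)"] unfolding normalize_shift assms by simp

text \<open>The map \<open>\<phi>\<close> is linear, so it carries the relation between consecutive
  powers of a letter to the points of the line. Centrality of \<open>hz\<close> lets the exponents
  be collected in front.\<close>

lemma mem_line:
  assumes "\<And>e v. (e, v) \<in> set (fst (line c)) \<Longrightarrow> zpow (k + e) * hword (g @ v @ h) \<in> M"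
    and "snd (line c) = (e, v)"
  shows "zpow (k + e) * hword (g @ v @ h) \<in> M"
proof -
  define \<phi> where "\<phi> x = zpow k * hword g * x * hword h" for x
  have commute: "zpow e * (hword g * r) = hword g * (zpow e * r)" for e r
    by (simp only: mult.assoc[symmetric] zpow_central[of e "hword g"])
  have split: "zpow (k + e) * hword (g @ v @ h) = \<phi> (zpow e * hword v)" for e v
    by (simp add: \<phi>_def hword_append zpow_add mult.assoc commute)
  have linear: "\<phi> (hscale a x + hscale b y) = hscale a (\<phi> x) + hscale b (\<phi> y)"
      "\<phi> (hscale a x + hscale b y + hscale d z) = hscale a (\<phi> x) + hscale b (\<phi> y) + hscale d (\<phi> z)"
    for a b d x y z
    by (simp_all add: \<phi>_def distrib_left distrib_right hscale_mult_left hscale_mult_right)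
  show ?thesis
  proof (cases "c = CHR ''u'' \<or> c = CHR ''U''")
    case True
    have "\<phi> 1 \<in> M" "\<phi> (gen c) \<in> M" "\<phi> (gen (opp c)) \<in> M"
      using assms(1)[of 0 "[]"] assms(1)[of 0 "[c]"] assms(1)[of 0 "[opp c]"] True
      unfolding split by (auto simp: line_def)
    moreover obtain a b d where "gen c * gen c = hscale a (gen c) + hscale b 1 + hscale d (gen (opp c))"
      using gen_square_span[OF True] by blast
    ultimately have "\<phi> (gen c * gen c) \<in> M"
      by (simp add: linear combination)
    then show ?thesis
      using assms(2) True unfolding split by (auto simp: line_def)
  next
    case False
    obtain e' v' where expand_c: "expand c = (e', v')"
      by fastforce
    have "\<phi> 1 \<in> M" "\<phi> (gen c) \<in> M"
      using assms(1)[of 0 "[]"] assms(1)[of e' v'] False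
      unfolding split by (auto simp: line_def expand_c expand[OF expand_c])
    moreover obtain a b where "gen (opp c) = hscale a (gen c) + hscale b 1"
      using gen_opp_span False by blast
    ultimately have "\<phi> (gen (opp c)) \<in> M"
      by (simp add: linear combination)
    then show ?thesis
      using assms(2) False expand[of "opp c" e v] unfolding split by (auto simp: line_def)
  qed
qed

lemma subsumed_mem:
  assumes "subsumed fs gs" "\<forall>f\<in>set fs. valid f" "(w, l, u) \<in> set gs" "l \<le> k" "k \<le> u"
  shows "zpow k * hword w \<in> M"
proof -
  obtain a b where "(w, a, b) \<in> set fs" "a \<le> k" "k \<le> b"
    by (rule subsumedD[OF assms(1,3-5)])
  then show ?thesis
    using bspec[OF assms(2), of "(w, a, b)"] by (simp add: valid_def)
qed

lemma extend_valid:
  assumes "\<forall>f\<in>set fs. valid f"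
  shows "\<forall>f\<in>set (extend fs (row_facts rules row)). valid f"
proof -
  obtain c g h a b where row: "row = (c, g, h, a, b)"
    by (cases row)
  obtain e v where concl: "snd (line c) = (e, v)"
    by fastforce
  obtain d w where place: "normalize rules (e, g @ v @ h) = (d, w)"
    by fastforce
  define gs where "gs = map (\<lambda>p. case case p of (e, v) \<Rightarrow> normalize rules (e, g @ v @ h) of
    (e, v) \<Rightarrow> (v, a + e - d, b + e - d)) (fst (line c))"
  have rf: "row_facts rules row = (gs, (w, a, b))"
    unfolding row row_facts.simps gs_def concl Let_def prod.case place by simp
  have "valid (w, a, b)" if sub: "subsumed fs gs"
    unfolding valid_def
  proof
    fix k
    assume k: "k \<in> {fst (snd (w, a, b))..snd (snd (w, a, b))}"
    \<comment> \<open>Here \<open>k\<close> is the exponent in the normal form of the new point, so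
      \<open>k - d\<close> is the parameter of the line.\<close>
    have "zpow (k - d + e) * hword (g @ v @ h) \<in> M"
    proof (rule mem_line[OF _ concl])
      fix e' v'
      assume mem: "(e', v') \<in> set (fst (line c))"
      obtain e'' v'' where n: "normalize rules (e', g @ v' @ h) = (e'', v'')"
        by fastforce
      have "(v'', a + e'' - d, b + e'' - d) \<in> set gs"
        unfolding gs_def set_map by (rule image_eqI[OF _ mem]) (simp add: n)
      then have "zpow (k - d + e'') * hword v'' \<in> M"
        by (rule subsumed_mem[OF sub assms]) (use k in auto)
      then show "zpow (k - d + e') * hword (g @ v' @ h) \<in> M"
        using mem_normalize_shift[OF n] by blast
    qed
    then have "zpow (k - d + d) * hword w \<in> M"
      using mem_normalize_shift[OF place] by blast
    then show "zpow k * hword (fst (w, a, b)) \<in> M"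
      by simp
  qed
  then show ?thesis
    using assms by (cases "subsumed fs gs") (auto simp only: rf extend.simps prepend_if.simps list.set)
qed

lemma saturate_valid: "\<forall>f\<in>set fs. valid f \<Longrightarrow> \<forall>f\<in>set (saturate rules rows fs). valid f"
proof (induction rows arbitrary: fs)
  case (Cons row rows)
  show ?case
    unfolding saturate.simps by (rule Cons.IH[OF extend_valid[OF Cons.prems]])
qed simp

lemma certifies_mem:
  assumes "certifies rules rows vs ws"
    and vs: "\<And>v k. v \<in> set vs \<Longrightarrow> k \<in> {0..11} \<Longrightarrow> zpow k * hword v \<in> M"
    and "w \<in> set ws" "k \<in> {0..11}"
  shows "zpow k * hword w \<in> M"
proof -
  have shift: "zpow (k + d) * hword x \<in> M \<longleftrightarrow> zpow k * hword v \<in> M"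
    if "normalize rules (unfold v) = (d, x)" for k d v x
    using mem_normalize_shift[of "fst (unfold v)" "snd (unfold v)" d x k] that hword_unfold[of v]
    by (simp add: zpow_add mult.assoc)
  let ?fs = "saturate rules rows (map (normal_fact rules) vs)"
  have "valid (normal_fact rules v)" if "v \<in> set vs" for v
    unfolding valid_def
  proof
    obtain d x where n: "normalize rules (unfold v) = (d, x)"
      by fastforce
    fix k
    assume "k \<in> {fst (snd (normal_fact rules v))..snd (snd (normal_fact rules v))}"
    then have "zpow (k - d) * hword v \<in> M"
      using vs[OF that, of "k - d"] by (auto simp: normal_fact_def n)
    then show "zpow k * hword (fst (normal_fact rules v)) \<in> M"
      using shift[OF n, of "k - d"] by (simp add: normal_fact_def n)
  qed
  then have "\<forall>f\<in>set (map (normal_fact rules) vs). valid f"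
    by simp
  then have valid: "\<forall>f\<in>set ?fs. valid f"
    by (rule saturate_valid)
  obtain d x where n: "normalize rules (unfold w) = (d, x)"
    by fastforce
  have "normal_fact rules w = (x, d, 11 + d)"
    by (simp add: normal_fact_def n)
  then have "(x, d, 11 + d) \<in> set (map (normal_fact rules) ws)"
    using assms(3) by (metis image_eqI set_map)
  then have "zpow (k + d) * hword x \<in> M"
    by (rule subsumed_mem[OF assms(1)[unfolded certifies_def] valid]) (use assms(4) in auto)
  then show ?thesis
    using shift[OF n] by blast
qed

end

section \<open>The module \<open>U\<close>\<close>

lemma set_multI: "x \<in> X \<Longrightarrow> y \<in> Y \<Longrightarrow> x * y \<in> X \<star> Y"
  unfolding set_mult_def by (rule hecke.span_base) blast

lemma subspace_set_mult: "hecke.subspace (X \<star> Y)"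
  unfolding set_mult_def by (rule hecke.subspace_span)

lemma set_mult_subset:
  assumes "hecke.subspace N" "\<And>x y. x \<in> X \<Longrightarrow> y \<in> Y \<Longrightarrow> x * y \<in> N"
  shows "X \<star> Y \<subseteq> N"
  unfolding set_mult_def by (rule hecke.span_minimal[OF _ assms(1)]) (use assms(2) in auto)

lemma subspace_left_mult:
  assumes "hecke.subspace N" shows "hecke.subspace {x. a * x \<in> N}"
  using assms by (auto simp: hecke.subspace_def distrib_left hscale_mult_right)

lemma subspace_right_mult:
  assumes "hecke.subspace N" shows "hecke.subspace {x. x * a \<in> N}"
  using assms by (auto simp: hecke.subspace_def distrib_right hscale_mult_left)

lemma set_mult_left_closed:
  assumes "\<And>x. x \<in> X \<Longrightarrow> a * x \<in> X" "y \<in> X \<star> Y"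
  shows "a * y \<in> X \<star> Y"
proof -
  have "X \<star> Y \<subseteq> {y. a * y \<in> X \<star> Y}"
    by (rule set_mult_subset[OF subspace_left_mult[OF subspace_set_mult]])
      (simp add: assms(1) set_multI flip: mult.assoc)
  then show ?thesis
    using assms(2) by blast
qed

lemma set_mult_right_closed:
  assumes "\<And>y. y \<in> Y \<Longrightarrow> y * a \<in> Y" "x \<in> X \<star> Y"
  shows "x * a \<in> X \<star> Y"
proof -
  have "X \<star> Y \<subseteq> {y. y * a \<in> X \<star> Y}"
    by (rule set_mult_subset[OF subspace_right_mult[OF subspace_set_mult]])
      (simp add: assms(1) set_multI mult.assoc)
  then show ?thesis
    using assms(2) by blast
qed

lemma set_mult_assoc_subset:
  assumes "hecke.subspace N" "\<And>x y z. x \<in> X \<Longrightarrow> y \<in> Y \<Longrightarrow> z \<in> Z \<Longrightarrow> x * y * z \<in> N"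
  shows "X \<star> Y \<star> Z \<subseteq> N"
proof (rule set_mult_subset[OF assms(1)])
  fix x z assume x: "x \<in> X \<star> Y" and z: "z \<in> Z"
  have "X \<star> Y \<subseteq> {x. x * z \<in> N}"
    by (rule set_mult_subset[OF subspace_right_mult[OF assms(1)]]) (use assms(2) z in simp)
  then show "x * z \<in> N"
    using x by blast
qed

section \<open>Subalgebras generated by one element\<close>

lemma hsubalgebra_hull: "hsubalgebra (hsubalgebra hull S)"
  by (rule hull_in) (auto simp: hsubalgebra_def intro: hecke.subspace_Inter)

lemma hsubalgebra_u: "hsubalgebra u1" "hsubalgebra u2" "hsubalgebra u3"
  unfolding u1_def u2_def u3_def by (rule hsubalgebra_hull)+

lemma mem_u: "1 \<in> u1" "1 \<in> u2" "1 \<in> u3" "hs \<in> u1" "ht \<in> u2" "hu \<in> u3"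
  using hsubalgebra_u hull_subset[of "{hs}" hsubalgebra] hull_subset[of "{ht}" hsubalgebra]
    hull_subset[of "{hu}" hsubalgebra]
  by (auto simp: hsubalgebra_def u1_def u2_def u3_def)

lemma u_mult: "x \<in> u1 \<Longrightarrow> y \<in> u1 \<Longrightarrow> x * y \<in> u1" "x \<in> u2 \<Longrightarrow> y \<in> u2 \<Longrightarrow> x * y \<in> u2"
  "x \<in> u3 \<Longrightarrow> y \<in> u3 \<Longrightarrow> x * y \<in> u3"
  using hsubalgebra_u by (auto simp: hsubalgebra_def)

lemma right_stabilizer: 
  assumes "hecke.subspace M" shows "hsubalgebra {a. \<forall>x\<in>M. x * a \<in> M}"
  using assms by (auto simp: hsubalgebra_def hecke.subspace_def distrib_left hscale_mult_right
      simp flip: mult.assoc)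

lemma left_stabilizer:
  assumes "hecke.subspace M" shows "hsubalgebra {a. \<forall>x\<in>M. a * x \<in> M}"
  using assms by (auto simp: hsubalgebra_def hecke.subspace_def distrib_right hscale_mult_left mult.assoc)

text \<open>By bilinearity, closure under products passes from \<open>B\<close> to its span, first
  in the right factor and then in the left one.\<close>

lemma hsubalgebra_span:
  assumes "1 \<in> B" "\<And>x y. x \<in> B \<Longrightarrow> y \<in> B \<Longrightarrow> x * y \<in> hecke.span B"
  shows "hsubalgebra (hecke.span B)"
proof -
  have left: "hecke.span B \<subseteq> {y. x * y \<in> hecke.span B}" if "x \<in> B" for x
    by (rule hecke.span_minimal) (use assms(2) that in \<open>auto intro: subspace_left_mult\<close>)
  have "hecke.span B \<subseteq> {x. x * y \<in> hecke.span B}" if "y \<in> hecke.span B" for y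
    by (rule hecke.span_minimal) (use left that in \<open>auto intro: subspace_right_mult\<close>)
  then show ?thesis
    using assms(1) by (auto simp: hsubalgebra_def intro: hecke.span_base)
qed

lemma span_combination:
  "x \<in> B \<Longrightarrow> y \<in> B \<Longrightarrow> hscale a x + hscale b y \<in> hecke.span B"
  "x \<in> B \<Longrightarrow> y \<in> B \<Longrightarrow> z \<in> B \<Longrightarrow> hscale a x + hscale b y + hscale c z \<in> hecke.span B"
  by (simp_all add: hecke.span_add hecke.span_scale hecke.span_base)

lemma quadratic_span:
  assumes "\<exists>c d. x = hscale c (hinv x) + hscale d 1" "x * hinv x = 1"
  shows "hsubalgebra hull {x} \<subseteq> hecke.span {1, x}"
proof (rule hull_minimal)
  obtain c d where "x = hscale c (hinv x) + hscale d 1"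
    using assms(1) by blast
  then have "x * x = x * (hscale c (hinv x) + hscale d 1)"
    by simp
  then have "x * x = hscale c 1 + hscale d x"
    by (simp add: distrib_left hscale_mult_right assms(2))
  then have "x * x \<in> hecke.span {1, x}"
    by (simp add: span_combination)
  then show "hsubalgebra (hecke.span {1, x})"
    by (intro hsubalgebra_span) (auto intro: hecke.span_base)
qed (auto intro: hecke.span_base)

lemma u1_span: "u1 \<subseteq> hecke.span {1, hs}"
  unfolding u1_def by (rule quadratic_span[OF s_span s_inverse(1)])

lemma u2_span: "u2 \<subseteq> hecke.span {1, ht}"
  unfolding u2_def by (rule quadratic_span[OF t_span t_inverse(1)])

text \<open>The spanning set is symmetric about \<open>1\<close>, as are the three known points on a
  line in direction \<open>u\<close>.\<close>

lemma u3_span: "u3 \<subseteq> hecke.span {1, hu, hinv hu}"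
  unfolding u3_def
proof (rule hull_minimal)
  have "hu * hu \<in> hecke.span {1, hu, hinv hu}" "hinv hu * hinv hu \<in> hecke.span {1, hu, hinv hu}"
    using u_square_span u_inverse_square_span by (auto simp: span_combination)
  then show "hsubalgebra (hecke.span {1, hu, hinv hu})"
    by (intro hsubalgebra_span) (auto intro: hecke.span_base simp: u_inverse)
qed (auto intro: hecke.span_base)

section \<open>Summands, generators and evident stability of \<open>U\<close>\<close>

definition Uk :: "nat \<Rightarrow> hecke_G15 set" where
  "Uk k = {hz ^ k} \<star> u3 \<star> u2 \<star> u1 \<star> u2 \<star> u1"

lemma U_eq: "U = {\<Sum>k\<in>{0..11}. f k | f. \<forall>k\<in>{0..11}. f k \<in> Uk k}"
  by (simp add: U_def Uk_def)

lemma subspace_Uk: "hecke.subspace (Uk k)"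
  unfolding Uk_def by (rule subspace_set_mult)

lemma subspace_U: "hecke.subspace U"
proof (rule hecke.subspaceI)
  show "0 \<in> U"
    unfolding U_eq using hecke.subspace_0[OF subspace_Uk] by (intro CollectI exI[of _ "\<lambda>_. 0"]) simp
next
  fix x y
  assume "x \<in> U" "y \<in> U"
  then obtain f g where "x = sum f {0..11}" "y = sum g {0..11}" "\<forall>k\<in>{0..11}. f k \<in> Uk k" "\<forall>k\<in>{0..11}. g k \<in> Uk k"
    unfolding U_eq by blast
  then show "x + y \<in> U"
    unfolding U_eq using hecke.subspace_add[OF subspace_Uk]
    by (intro CollectI exI[of _ "\<lambda>k. f k + g k"]) (simp add: sum.distrib)
next
  fix c x
  assume "x \<in> U"
  then obtain f where "x = sum f {0..11}" "\<forall>k\<in>{0..11}. f k \<in> Uk k"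
    unfolding U_eq by blast
  then show "hscale c x \<in> U"
    unfolding U_eq using hecke.subspace_scale[OF subspace_Uk]
    by (intro CollectI exI[of _ "\<lambda>k. hscale c (f k)"]) (simp add: hecke.scale_sum_right)
qed

lemma Uk_subset_U:
  assumes "k \<le> 11" shows "Uk k \<subseteq> U"
proof
  fix x assume x: "x \<in> Uk k"
  have "x = (\<Sum>j\<in>{0..11}. if j = k then x else 0)"
    using assms by (simp add: sum.delta)
  then show "x \<in> U"
    unfolding U_eq using x hecke.subspace_0[OF subspace_Uk]
    by (intro CollectI exI[of _ "\<lambda>j. if j = k then x else 0"]) auto
qed

lemma U_subset:
  assumes "hecke.subspace N" "\<And>k. k \<le> 11 \<Longrightarrow> Uk k \<subseteq> N"
  shows "U \<subseteq> N"
  unfolding U_eq using assms(2) by (fastforce intro!: hecke.subspace_sum[OF assms(1)])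

text \<open>The factor \<open>hu\<close> passes \<open>hz ^ k\<close> by centrality and is then
  absorbed by \<open>u3\<close>.\<close>

lemma left_u_U: "x \<in> U \<Longrightarrow> hu * x \<in> U"
proof -
  note left = set_mult_left_closed[rotated]
  have base: "hu * x \<in> {hz ^ k} \<star> u3" if "x \<in> {hz ^ k} \<star> u3" for x k
  proof -
    have "{hz ^ k} \<star> u3 \<subseteq> {x. hu * x \<in> {hz ^ k} \<star> u3}"
    proof (rule set_mult_subset[OF subspace_left_mult[OF subspace_set_mult]])
      fix x y
      assume "x \<in> {hz ^ k}" "y \<in> u3"
      then have "hu * (x * y) = hz ^ k * (hu * y)" "hu * y \<in> u3"
        using zpow_central[of "int k" hu] by (simp_all add: zpow_of_nat mem_u u_mult flip: mult.assoc)
      then show "x * y \<in> {x. hu * x \<in> {hz ^ k} \<star> u3}"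
        by (simp add: set_multI)
    qed
    then show ?thesis
      using that by blast
  qed
  have "hu * x \<in> Uk k" if "x \<in> Uk k" for x k
    using that unfolding Uk_def by - (erule left, erule left, erule left, erule left, erule base)
  then have "U \<subseteq> {x. hu * x \<in> U}"
    using Uk_subset_U by (intro U_subset subspace_left_mult subspace_U) blast
  then show "x \<in> U \<Longrightarrow> hu * x \<in> U"
    by blast
qed

lemma right_s_U: "x \<in> U \<Longrightarrow> x * hs \<in> U"
proof -
  have "x * hs \<in> Uk k" if "x \<in> Uk k" for x k
    using that unfolding Uk_def by (rule set_mult_right_closed[rotated]) (simp add: u_mult mem_u)
  then have "U \<subseteq> {x. x * hs \<in> U}"
    using Uk_subset_U by (intro U_subset subspace_right_mult subspace_U) blast
  then show "x \<in> U \<Longrightarrow> x * hs \<in> U"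
    by blast
qed

lemma generator_mem_U:
  assumes "k \<le> 11" "a \<in> u3" "b \<in> u2" "c \<in> u1" "d \<in> u2" "e \<in> u1"
  shows "hz ^ k * a * b * c * d * e \<in> U"
proof -
  have "hz ^ k * a * b * c * d * e \<in> Uk k"
    unfolding Uk_def using assms by (intro set_multI) auto
  then show ?thesis
    using Uk_subset_U[OF assms(1)] by blast
qed

text \<open>Factors are peeled off from the right; at each stage the target becomes its preimage
  under right multiplication, again a submodule.\<close>

lemma U_subset_generators:
  assumes "hecke.subspace N"
    "\<And>k a b c d e. k \<le> 11 \<Longrightarrow> a \<in> u3 \<Longrightarrow> b \<in> u2 \<Longrightarrow> c \<in> u1 \<Longrightarrow> d \<in> u2 \<Longrightarrow> e \<in> u1 \<Longrightarrow>
      hz ^ k * a * b * c * d * e \<in> N"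
  shows "U \<subseteq> N"
proof (rule U_subset[OF assms(1)])
  fix k :: nat
  assume k: "k \<le> 11"
  note sub = subspace_right_mult[OF assms(1)] 
  show "Uk k \<subseteq> N"
    unfolding Uk_def
  proof (rule set_mult_subset[OF assms(1)])
    fix x e assume "x \<in> {hz ^ k} \<star> u3 \<star> u2 \<star> u1 \<star> u2" and e: "e \<in> u1"
    moreover have "{hz ^ k} \<star> u3 \<star> u2 \<star> u1 \<star> u2 \<subseteq> {x. x * e \<in> N}"
    proof (rule set_mult_subset[OF sub], unfold mem_Collect_eq)
      fix x d assume "x \<in> {hz ^ k} \<star> u3 \<star> u2 \<star> u1" and d: "d \<in> u2"
      moreover have "{hz ^ k} \<star> u3 \<star> u2 \<star> u1 \<subseteq> {x. x * d * e \<in> N}"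
      proof (rule set_mult_subset, goal_cases)
        case 1
        then show ?case
          using subspace_right_mult[OF sub[of e], of d] by simp
      next
        case (2 x c)
        moreover have "{hz ^ k} \<star> u3 \<star> u2 \<subseteq> {x. x * c * d * e \<in> N}"
        proof (rule set_mult_assoc_subset, goal_cases)
          case 1
          then show ?case
            using subspace_right_mult[OF subspace_right_mult[OF sub[of e], of d], of c] by simp
        next
          case (2 x a b)
          then show ?case
            using assms(2)[OF k _ _ \<open>c \<in> u1\<close> d e] by simp
        qed
        ultimately show ?case
          by blast
      qed
      ultimately show "x * d * e \<in> N"
        by blast
    qed
    ultimately show "x * e \<in> N"
      by blast
  qed
qed

section \<open>The two derivations\<close>

text \<open>The rules come from right multiplication by \<open>s\<close> and \<open>s\<^sup>-\<^sup>1\<close>, respectively.\<close>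

definition s_rules :: "tail_rule list" where
  "s_rules = [(''tu'', ''UT'', 1), (''TUT'', ''u'', - 1)]"

text \<open>
  The rules come from right multiplication by \<open>t\<^sup>-\<^sup>1\<close>, \<open>t\<close>, \<open>st\<close> and \<open>t\<^sup>-\<^sup>1s\<^sup>-\<^sup>1\<close>, respectively.
\<close>

definition st_rules :: "tail_rule list" where
  "st_rules = [(''t'', [], 0), (''T'', [], 0), (''tu'', ''U'', 1), (''TU'', ''u'', - 1)]"

text \<open>Products of the spanning elements \<open>1\<close>, \<open>ht\<close> and
  \<open>1\<close>, \<open>hs\<close> of the last four factors of \<open>U\<close>, followed by
  \<open>ht\<close>. The factor from \<open>u3\<close> is left to the left stability of
  \<open>U\<close>.\<close>

definition dihedral_words :: "string list" where
  "dihedral_words = [b @ c @ d @ e @ ''t''.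
     b \<leftarrow> [[], ''t''], c \<leftarrow> [[], ''s''], d \<leftarrow> [[], ''t''], e \<leftarrow> [[], ''s'']]"

text \<open>
  The following two tables were found by a computer search: saturate the initial facts under moves
  along lines through short words, then delete moves as long as the goal is still reached.
\<close>

definition right_t_rows :: "row list" where
  "right_t_rows =
    [(CHR ''t'', [], ''UTU'', 2, 12), (CHR ''s'', [], ''U'', 0, 10), (CHR ''t'', [], [], 1, 11),
     (CHR ''T'', [], ''U'', 1, 10), (CHR ''u'', ''t'', [], 1, 10), (CHR ''t'', ''tu'', [], 1, 10),
     (CHR ''T'', [], ''UT'', 1, 10), (CHR ''t'', ''tu'', ''u'', 2, 10),
     (CHR ''u'', ''t'', ''T'', 1, 9), (CHR ''T'', ''tuu'', [], 1, 9),
     (CHR ''T'', ''tu'', ''UT'', 2, 10), (CHR ''s'', [], ''t'', 2, 10),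
     (CHR ''t'', ''tutu'', [], 2, 10), (CHR ''t'', [], ''u'', 2, 9), (CHR ''U'', ''T'', [], 2, 9),
     (CHR ''s'', [], ''tU'', 0, 7), (CHR ''U'', ''t'', ''T'', 4, 10),
     (CHR ''t'', ''tU'', ''u'', 3, 9), (CHR ''t'', [], ''UTu'', 3, 9), (CHR ''s'', [], ''u'', 1, 7),
     (CHR ''U'', ''tut'', ''u'', 1, 7), (CHR ''t'', ''tu'', ''U'', 1, 7),
     (CHR ''s'', [], ''tut'', 4, 9), (CHR ''U'', ''tut'', ''T'', 5, 10),
     (CHR ''U'', ''t'', ''TU'', 2, 7), (CHR ''t'', [], ''UUTU'', 2, 7),
     (CHR ''t'', [], ''ututU'', 2, 7), (CHR ''t'', [], ''utut'', 4, 9),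
     (CHR ''S'', [], ''UTU'', 6, 11), (CHR ''T'', [], ''UTUTU'', 6, 11),
     (CHR ''u'', ''tut'', ''T'', 2, 7), (CHR ''S'', [], ''uT'', 4, 9),
     (CHR ''T'', ''TUTu'', [], 4, 9), (CHR ''t'', ''tutu'', ''U'', 0, 5),
     (CHR ''u'', ''t'', ''TU'', 1, 6), (CHR ''T'', ''tuu'', ''U'', 1, 6),
     (CHR ''u'', ''tuut'', [], 1, 6), (CHR ''S'', ''tuT'', ''u'', 3, 8),
     (CHR ''T'', ''tuTUTU'', ''u'', 4, 9), (CHR ''T'', ''TU'', ''ut'', 4, 9),
     (CHR ''t'', ''tutU'', ''u'', 4, 9), (CHR ''t'', ''tu'', ''UTu'', 4, 9),
     (CHR ''u'', ''T'', ''tut'', 4, 9), (CHR ''T'', [], ''uutut'', 4, 9),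
     (CHR ''t'', ''tu'', ''utut'', 4, 9), (CHR ''S'', ''tuT'', ''t'', 6, 11),
     (CHR ''u'', ''t'', ''TUTU'', 6, 11), (CHR ''T'', ''tu'', ''UTU'', 6, 11),
     (CHR ''S'', [], ''UUTU'', 8, 13), (CHR ''U'', ''tuTUT'', [], 6, 9),
     (CHR ''T'', ''tuTUTUU'', [], 6, 9), (CHR ''T'', ''tuTUTU'', [], 6, 9),
     (CHR ''s'', ''tuT'', ''tU'', 4, 7), (CHR ''t'', [], ''uututU'', 4, 7),
     (CHR ''U'', ''T'', ''ututU'', 4, 7), (CHR ''t'', ''TU'', ''utU'', 4, 7),
     (CHR ''t'', ''TUTu'', ''U'', 4, 7), (CHR ''s'', [], ''uTU'', 2, 5),
     (CHR ''U'', ''tut'', ''uTU'', 2, 5), (CHR ''t'', ''tu'', ''UTU'', 4, 5),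
     (CHR ''U'', ''tuTUT'', [], 4, 5), (CHR ''T'', ''tuTUTUU'', [], 4, 5),
     (CHR ''T'', ''tuTUTU'', [], 4, 5), (CHR ''s'', ''tuT'', ''tU'', 2, 3),
     (CHR ''t'', [], ''uututU'', 2, 3), (CHR ''U'', ''T'', ''ututU'', 2, 3),
     (CHR ''t'', ''TU'', ''utU'', 2, 3), (CHR ''t'', ''TUTu'', ''U'', 2, 3),
     (CHR ''s'', [], ''uTU'', 0, 1), (CHR ''U'', ''tut'', ''uTU'', 0, 1),
     (CHR ''S'', [], ''UUTU'', 2, 7), (CHR ''T'', [], ''UTUUTU'', 2, 7),
     (CHR ''u'', ''tuTUT'', ''Ut'', 4, 7), (CHR ''T'', ''tuTU'', ''ut'', 4, 7),
     (CHR ''u'', ''tuT'', ''tut'', 4, 7), (CHR ''S'', ''tuTuT'', ''t'', 6, 9),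
     (CHR ''T'', ''tu'', ''uTUTU'', 6, 9), (CHR ''T'', ''tutu'', ''UTU'', 6, 9),
     (CHR ''S'', [], ''tUTU'', 8, 11), (CHR ''T'', [], ''UUTU'', 8, 9),
     (CHR ''u'', ''t'', ''UTU'', 8, 9), (CHR ''u'', ''tuTUT'', ''Ut'', 8, 9),
     (CHR ''T'', ''tuTU'', ''ut'', 8, 9), (CHR ''u'', ''tuT'', ''tut'', 8, 9),
     (CHR ''S'', ''tuTuT'', ''t'', 10, 11), (CHR ''T'', ''tu'', ''uTUTU'', 10, 11),
     (CHR ''T'', ''tutu'', ''UTU'', 10, 11), (CHR ''S'', [], ''tUTU'', 12, 13),
     (CHR ''T'', [], ''UTUUTU'', 8, 13), (CHR ''T'', [], ''t'', 0, 11),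
     (CHR ''T'', [], ''tt'', 0, 11), (CHR ''T'', ''TU'', [], 1, 12),
     (CHR ''T'', ''tUTU'', [], 1, 12), (CHR ''T'', [], ''tUTU'', 1, 12),
     (CHR ''S'', [], ''UTU'', 2, 13), (CHR ''S'', ''t'', ''UTU'', 2, 13)]"

definition left_rows :: "row list" where
  "left_rows =
    [(CHR ''T'', [], ''U'', 1, 11), (CHR ''u'', ''t'', [], 7, 9), (CHR ''T'', ''tu'', ''U'', 8, 10),
     (CHR ''S'', [], ''UU'', 10, 12), (CHR ''u'', ''TUT'', ''U'', 10, 12),
     (CHR ''T'', ''TU'', ''TU'', 11, 11), (CHR ''T'', [], ''UU'', 11, 11),
     (CHR ''u'', ''t'', ''U'', 12, 12), (CHR ''t'', [], ''u'', 0, 11),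
     (CHR ''U'', ''T'', [], 1, 10), (CHR ''t'', ''TU'', ''TU'', 1, 9),
     (CHR ''U'', ''TUT'', [], 3, 3), (CHR ''t'', ''TUTU'', ''u'', 2, 2),
     (CHR ''U'', ''TUTUT'', [], 2, 2), (CHR ''s'', [], ''UTUU'', 0, 0)]"

text \<open>Up to left factors from \<open>u3\<close> and right factors from \<open>u1\<close>, the
  four initial words span the part of \<open>U\<close> belonging to a fixed power of
  \<open>z\<close>.\<close>

lemma right_t_certificate:
  "certifies s_rules right_t_rows [[], ''t'', ''st'', ''tst''] dihedral_words"
  by code_simp

text \<open>The goals are \<open>ht\<close> and \<open>hs\<close> times the spanning elements
  \<open>1\<close>, \<open>hu\<close>, \<open>hinv hu\<close> of \<open>u3\<close>.\<close>

lemma left_certificate: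
  "certifies st_rules left_rows [[]] [''t'', ''tu'', ''tU'', ''s'', ''su'', ''sU'']"
  by code_simp

section \<open>Tail rules from right stability\<close>

lemma right_stable_hword:
  assumes "\<And>c x. c \<in> set w \<Longrightarrow> x * gen c \<in> M \<longleftrightarrow> x \<in> M"
  shows "x * hword w \<in> M \<longleftrightarrow> x \<in> M"
  using assms by (induction w arbitrary: x) (simp_all flip: mult.assoc)

text \<open>Right multiplication by \<open>hword w\<close> preserves and reflects membership in
  \<open>M\<close>; it turns the tail \<open>p\<close> into \<open>q\<close> at the cost of
  \<open>zpow d\<close>.\<close>

lemma tail_rule_by_right_mult:
  assumes "unfold w = (d, x)" "reduce (p @ x) = q"
    and "\<And>c x. c \<in> set w \<Longrightarrow> x * gen c \<in> M \<longleftrightarrow> x \<in> M"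
  shows "zpow k * hword (v @ p) \<in> M \<longleftrightarrow> zpow (k + d) * hword (v @ q) \<in> M"
proof -
  have "hword w = zpow d * hword x"
    using hword_unfold[of w] assms(1) by simp
  then have "hword (v @ p) * hword w = zpow d * (hword (v @ p) * hword x)"
    by (metis mult.assoc zpow_central)
  also have "hword (v @ p) * hword x = hword (v @ q)"
    using hword_reduce[of "p @ x"] assms(2) by (simp add: hword_append mult.assoc)
  finally have "zpow k * hword (v @ p) * hword w = zpow (k + d) * hword (v @ q)"
    by (simp add: zpow_add mult.assoc)
  then show ?thesis
    using right_stable_hword[OF assms(3)] by metis
qed

text \<open>Since \<open>hinv a\<close> is a combination of \<open>a\<close> and \<open>1\<close>,
  stability under \<open>a\<close> implies stability under \<open>hinv a\<close>, which gives the
  converse implications.\<close>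

lemma right_unit_iff:
  assumes "hecke.subspace M" "\<And>x. x \<in> M \<Longrightarrow> x * a \<in> M"
    and "a * hinv a = 1" "hinv a * a = 1" "\<exists>c d. hinv a = hscale c a + hscale d 1"
  shows "x * a \<in> M \<longleftrightarrow> x \<in> M" "x * hinv a \<in> M \<longleftrightarrow> x \<in> M"
proof -
  obtain c d where eq: "hinv a = hscale c a + hscale d 1"
    using assms(5) by blast
  have "y * hinv a = hscale c (y * a) + hscale d y" for y
    by (subst eq) (simp add: distrib_left hscale_mult_right)
  then have stable: "y * hinv a \<in> M" if "y \<in> M" for y
    using assms(1,2) that by (simp add: hecke.subspace_add hecke.subspace_scale)
  have "x * a * hinv a = x" "x * hinv a * a = x"
    by (simp_all add: mult.assoc assms(3,4))
  then show "x * a \<in> M \<longleftrightarrow> x \<in> M" "x * hinv a \<in> M \<longleftrightarrow> x \<in> M"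
    using stable assms(2) by metis+
qed

lemma right_gen_iff:
  assumes "hecke.subspace M"
  shows "(\<And>x. x \<in> M \<Longrightarrow> x * hs \<in> M) \<Longrightarrow> c = CHR ''s'' \<or> c = CHR ''S'' \<Longrightarrow> x * gen c \<in> M \<longleftrightarrow> x \<in> M"
    and "(\<And>x. x \<in> M \<Longrightarrow> x * ht \<in> M) \<Longrightarrow> c = CHR ''t'' \<or> c = CHR ''T'' \<Longrightarrow> x * gen c \<in> M \<longleftrightarrow> x \<in> M"
  using right_unit_iff[OF assms _ s_inverse s_inverse_span, of x]
    right_unit_iff[OF assms _ t_inverse t_inverse_span, of x]
  by (auto simp: gen_def)

lemma word_span_s:
  assumes M: "hecke.subspace M" "\<And>x. x \<in> M \<Longrightarrow> hu * x \<in> M" "\<And>x. x \<in> M \<Longrightarrow> x * hs \<in> M"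
  shows "word_span M s_rules"
proof
  fix p q d k v
  assume "(p, q, d) \<in> set s_rules"
  moreover have "unfold ''s'' = (1, ''UTUT'')" "reduce (''tu'' @ ''UTUT'') = ''UT''"
    "unfold ''S'' = (- 1, ''tutu'')" "reduce (''TUT'' @ ''tutu'') = ''u''"
    by code_simp+
  ultimately obtain w x where w: "unfold w = (d, x)" "reduce (p @ x) = q"
      "set w \<subseteq> {CHR ''s'', CHR ''S''}"
    unfolding s_rules_def using that[of "''s''"] that[of "''S''"] by auto
  show "zpow k * hword (v @ p) \<in> M \<longleftrightarrow> zpow (k + d) * hword (v @ q) \<in> M"
    by (rule tail_rule_by_right_mult[OF w(1,2)]) (use w(3) right_gen_iff(1)[OF M(1,3)] in auto)
qed (use M in auto)

lemma word_span_st: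
  assumes M: "hecke.subspace M" "\<And>x. x \<in> M \<Longrightarrow> hu * x \<in> M" "\<And>x. x \<in> M \<Longrightarrow> x * hs \<in> M"
    "\<And>x. x \<in> M \<Longrightarrow> x * ht \<in> M"
  shows "word_span M st_rules"
proof
  fix p q d k v
  assume "(p, q, d) \<in> set st_rules"
  moreover have "unfold ''T'' = (0, ''T'')" "reduce (''t'' @ ''T'') = []"
    "unfold ''t'' = (0, ''t'')" "reduce (''T'' @ ''t'') = []"
    "unfold ''st'' = (1, ''UTUTt'')" "reduce (''tu'' @ ''UTUTt'') = ''U''"
    "unfold ''TS'' = (- 1, ''Ttutu'')" "reduce (''TU'' @ ''Ttutu'') = ''u''"
    by code_simp+
  ultimately obtain w x where w: "unfold w = (d, x)" "reduce (p @ x) = q"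
      "set w \<subseteq> {CHR ''s'', CHR ''S'', CHR ''t'', CHR ''T''}"
    unfolding st_rules_def
    using that[of "''T''"] that[of "''t''"] that[of "''st''"] that[of "''TS''"] by auto
  show "zpow k * hword (v @ p) \<in> M \<longleftrightarrow> zpow (k + d) * hword (v @ q) \<in> M"
    by (rule tail_rule_by_right_mult[OF w(1,2)])
      (use w(3) right_gen_iff(1)[OF M(1,3)] right_gen_iff(2)[OF M(1,4)] in auto)
qed (use M in auto)

lemma u1_span_mem:
  assumes "hecke.subspace N" "x * y \<in> N" "x * (hs * y) \<in> N" "a \<in> u1"
  shows "x * (a * y) \<in> N"
proof -
  have "hecke.span {1, hs} \<subseteq> {a. x * (a * y) \<in> N}"
    by (rule hecke.span_minimal)
      (use assms(2,3) subspace_right_mult[OF subspace_left_mult[OF assms(1)]] in auto)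
  then show ?thesis
    using assms(4) u1_span by blast
qed

lemma u2_span_mem:
  assumes "hecke.subspace N" "x * y \<in> N" "x * (ht * y) \<in> N" "a \<in> u2"
  shows "x * (a * y) \<in> N"
proof -
  have "hecke.span {1, ht} \<subseteq> {a. x * (a * y) \<in> N}"
    by (rule hecke.span_minimal)
      (use assms(2,3) subspace_right_mult[OF subspace_left_mult[OF assms(1)]] in auto)
  then show ?thesis
    using assms(4) u2_span by blast
qed

lemma u3_span_mem:
  assumes "hecke.subspace N" "x \<in> N" "x * hu \<in> N" "x * hinv hu \<in> N" "a \<in> u3"
  shows "x * a \<in> N"
proof -
  have "hecke.span {1, hu, hinv hu} \<subseteq> {a. x * a \<in> N}"
    by (rule hecke.span_minimal) (use assms(2-4) subspace_left_mult[OF assms(1)] in auto)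
  then show ?thesis
    using assms(5) u3_span by blast
qed

lemma zpow_eq_power: "k \<in> {0..11} \<Longrightarrow> \<exists>n\<le>11. zpow k = hz ^ n"
  by (intro exI[of _ "nat k"]) (auto simp: zpow_def)

lemma left_u3_U: "a \<in> u3 \<Longrightarrow> x \<in> U \<Longrightarrow> a * x \<in> U"
proof -
  have "u3 \<subseteq> {a. \<forall>x\<in>U. a * x \<in> U}"
    unfolding u3_def by (rule hull_minimal) (use left_u_U left_stabilizer[OF subspace_U] in auto)
  then show "a \<in> u3 \<Longrightarrow> x \<in> U \<Longrightarrow> a * x \<in> U"
    by blast
qed

lemma power_z_central: "hz ^ k * x = x * hz ^ k"
  using zpow_central[of "int k"] by (simp add: zpow_of_nat)

section \<open>Stability of \<open>U\<close> under the remaining generators\<close>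

lemma right_t_U:
  assumes "x \<in> U"
  shows "x * ht \<in> U"
proof -
  interpret word_span U s_rules
    by (rule word_span_s[OF subspace_U left_u_U right_s_U])
  have start: "zpow k * hword w \<in> U" if w: "w \<in> set [[], ''t'', ''st'', ''tst'']" and k: "k \<in> {0..11}" for w k
  proof -
    obtain n where n: "n \<le> 11" "zpow k = hz ^ n"
      using zpow_eq_power[OF k] by blast
    show ?thesis
      using w generator_mem_U[OF n(1), of 1 1 1 1 1] generator_mem_U[OF n(1), of 1 ht 1 1 1]
        generator_mem_U[OF n(1), of 1 1 hs ht 1] generator_mem_U[OF n(1), of 1 ht hs ht 1] mem_u
      by (auto simp: n(2) gen_def mult.assoc)
  qed
  have words: "hz ^ n * hword w \<in> U" if "w \<in> set dihedral_words" "n \<le> 11" for w n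
    using certifies_mem[OF right_t_certificate start that(1), of "int n"] that(2)
    by (simp add: zpow_of_nat)
  have "U \<subseteq> {x. x * ht \<in> U}"
  proof (rule U_subset_generators[OF subspace_right_mult[OF subspace_U]])
    fix k :: nat and a b c d e
    assume k: "k \<le> 11" and a: "a \<in> u3" and b: "b \<in> u2" and c: "c \<in> u1" and d: "d \<in> u2" and e: "e \<in> u1"
    note sub = subspace_U
    \<comment> \<open>The factors are released one at a time, from spanning elements to all of
      \<open>u1\<close> or \<open>u2\<close>, in the order \<open>e\<close>, \<open>d\<close>,
      \<open>c\<close>, \<open>b\<close>.\<close>
    have 1: "hz ^ k * (b * (c * (d * (e * ht)))) \<in> U"
      if "b \<in> {1, ht}" "c \<in> {1, hs}" "d \<in> {1, ht}" "e \<in> {1, hs}" for b c d e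
    proof -
      have "\<exists>w\<in>set dihedral_words. hword w = b * (c * (d * (e * ht)))"
        using that by (auto simp: dihedral_words_def gen_def mult.assoc)
      then show ?thesis
        using words[OF _ k] by metis
    qed
    have 2: "hz ^ k * (b * (c * (d * (e * ht)))) \<in> U"
      if "b \<in> {1, ht}" "c \<in> {1, hs}" "d \<in> {1, ht}" for b c d
      using that 1[of b c d 1] 1[of b c d hs] u1_span_mem[OF sub _ _ e, of "hz ^ k * b * c * d" ht]
      by (simp add: mult.assoc)
    have 3: "hz ^ k * (b * (c * (d * (e * ht)))) \<in> U" if "b \<in> {1, ht}" "c \<in> {1, hs}" for b c
      using that 2[of b c 1] 2[of b c ht] u2_span_mem[OF sub _ _ d, of "hz ^ k * b * c" "e * ht"]
      by (simp add: mult.assoc)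
    have 4: "hz ^ k * (b * (c * (d * (e * ht)))) \<in> U" if "b \<in> {1, ht}" for b
      using that 3[of b 1] 3[of b hs] u1_span_mem[OF sub _ _ c, of "hz ^ k * b" "d * (e * ht)"]
      by (simp add: mult.assoc)
    have "hz ^ k * (b * (c * (d * (e * ht)))) \<in> U"
      using 4[of 1] 4[of ht] u2_span_mem[OF sub _ _ b, of "hz ^ k" "c * (d * (e * ht))"]
      by (simp add: mult.assoc)
    then have "a * (hz ^ k * (b * (c * (d * (e * ht))))) \<in> U"
      by (rule left_u3_U[OF a])
    then show "hz ^ k * a * b * c * d * e \<in> {x. x * ht \<in> U}"
      by (simp add: power_z_central[of k a] mult.assoc)
  qed
  then show ?thesis
    using assms by blast
qed

lemma left_closed_U:
  assumes "x \<in> U"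
  shows "ht * x \<in> U" "hs * x \<in> U"
proof -
  interpret word_span U st_rules
    by (rule word_span_st[OF subspace_U left_u_U right_s_U right_t_U])
  have start: "zpow k * hword w \<in> U" if w: "w \<in> set [[]]" and k: "k \<in> {0..11}" for w k
  proof -
    obtain n where "n \<le> 11" "zpow k = hz ^ n"
      using zpow_eq_power[OF k] by blast
    then show ?thesis
      using w generator_mem_U[of n 1 1 1 1 1] mem_u by simp
  qed
  have words: "hz ^ n * hword w \<in> U" if "w \<in> set [''t'', ''tu'', ''tU'', ''s'', ''su'', ''sU'']" "n \<le> 11" for w n
    using certifies_mem[OF left_certificate start that(1), of "int n"] that(2)
    by (simp add: zpow_of_nat)
  have u1: "u1 \<subseteq> {a. \<forall>x\<in>U. x * a \<in> U}"
    unfolding u1_def by (rule hull_minimal) (use right_s_U right_stabilizer[OF subspace_U] in auto)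
  have u2: "u2 \<subseteq> {a. \<forall>x\<in>U. x * a \<in> U}"
    unfolding u2_def by (rule hull_minimal) (use right_t_U right_stabilizer[OF subspace_U] in auto)
  have "U \<subseteq> {x. g * x \<in> U}" if g: "g \<in> {hs, ht}" for g
  proof (rule U_subset_generators[OF subspace_left_mult[OF subspace_U]])
    fix k :: nat and a b c d e
    assume k: "k \<le> 11" and a: "a \<in> u3" and bcde: "b \<in> u2" "c \<in> u1" "d \<in> u2" "e \<in> u1"
    \<comment> \<open>Only the product of \<open>g\<close> with the factor from \<open>u3\<close>
      needs the certificate; the other factors act on the right, where \<open>U\<close> is already
      stable.\<close>
    have "hz ^ k * g * a \<in> U"
      using words[OF _ k, of "''t''"] words[OF _ k, of "''tu''"] words[OF _ k, of "''tU''"]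
        words[OF _ k, of "''s''"] words[OF _ k, of "''su''"] words[OF _ k, of "''sU''"] g
      by (intro u3_span_mem[OF subspace_U _ _ _ a]) (auto simp: gen_def mult.assoc)
    then have "hz ^ k * g * a * b * c * d * e \<in> U"
      using bcde u1 u2 by blast
    then show "hz ^ k * a * b * c * d * e \<in> {x. g * x \<in> U}"
      by (simp add: power_z_central[of k g] mult.assoc)
  qed
  then show "ht * x \<in> U" "hs * x \<in> U"
    using assms by blast+
qed

theorem theorem4p3p54:
  shows "(UNIV :: hecke_G15 set) = U"
proof -
  have "1 \<in> U"
    using generator_mem_U[of 0 1 1 1 1 1] mem_u by simp
  \<comment> \<open>The left stabilizer is a subalgebra containing all three generators, hence
    everything; acting on \<open>1\<close> it puts each \<open>a\<close> into
    \<open>U\<close>.\<close>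
  moreover have "a \<in> {a. \<forall>x\<in>U. a * x \<in> U}" for a
    by (rule hecke_G15_generated[OF left_stabilizer[OF subspace_U]])
      (use left_u_U left_closed_U in auto)
  ultimately have "a \<in> U" for a
    by fastforce
  then show ?thesis
    by blast
qed

end
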